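(* Let $g_0,g_1,\dots,g_m\in C^\infty(\mathbb{R}^n;\mathbb{R}^n)$ be complete vector fields with flows $G_0,G_1,\dots,G_m$. Let $x^*\in\mathbb{R}^n$, $\gamma>0$, $T>0$, $a_1,\dots,a_m>0$, $K_1>0$. Assume: ($I_1$) $g_1,\dots,g_m$ are in involution over the reals on $B(x^*,3\gamma)$, and $[g_0,g_i](x)=0$ for all $x\in B(x^*,3\gamma)$, $1\le i\le m$; ($I_2$) $u\in\mathcal{U}_a$, each $u_i(\cdot,\lambda)$ ($1\le i\le m$) has bounded variation on $[0,T]$, and for all $x\in B(x^*,3\gamma)$, $|t|\le T$, $|t_i|\le a_i$, $1\le i\le m$, one has $|G_0(t)[x]-x|\le\frac{\gamma}{2(m+1)}$ and $|G_i(t_i)[x]-x|\le\frac{\gamma}{2(m+1)}$; and $C_1C_2K_1=\rho\in[0,\tfrac12]$, where $C_1=\max\{|\partial_y(z(p;y))g_i(y)|:p\in\square,\ y\in B(x^*,2\gamma),\ 1\le i\le m\}$ and $C_2=\max\{|A(p)|:p\in\square\}$. Assume moreover that $u$ is continuously differentiable on each continuity interval, i.e. on $[t_k,t_{k+1})\times\mathbb{R}^n$, $0\le k\le N-1$. Then the unique solution $\lambda=\psi^u(t,x)\in B(x^*,2\gamma)$, $t\in[t_k,t_{k+1})$, $x\in\operatorname{int}B(x^*,\gamma)$, of the equation $$G_0(t)\circ G(u(t,\lambda))[\lambda]=x$$ satisfies $$\partial_t\psi^u(t,x)+\partial_x\psi^u(t,x)\Big[g_0(x)+\sum_{i=1}^m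 g_i(x)\,\partial_t\beta_i^u(t,\psi^u(t,x))\Big]=0$$ for all $t\in[t_k,t_{k+1})$, $x\in\operatorname{int}B(x^*,\gamma)$, $0\le k\le N-1$, where $\partial_t\beta_i^u(t,\psi^u(t,x))$ denotes the partial derivative $\partial_t\beta_i^u(t,\lambda)$ evaluated at $\lambda=\psi^u(t,x)$.
   Context: $B(x^*,r)$ is the closed ball of radius $r$ centered at $x^*$ in $\mathbb{R}^n$. $G_i(t)[x]$ is the flow of $g_i$ at time $t$ started at $x$. Put $\square=\prod_{i=1}^m[-a_i,a_i]\subset\mathbb{R}^m$ and, for $p=(t_1,\dots,t_m)\in\square$, $G(p)[x]=G_1(t_1)\circ\dots\circ G_m(t_m)[x]$, $H(p)[x]=[G(p)]^{-1}(x)=G_m(-t_m)\circ\dots\circ G_1(-t_1)[x]$, $z(p;y)=H(p)[y]$. Involution over the reals on $B(x^*,3\gamma)$: there are constants $\gamma^{ij}_k\in\mathbb{R}$ such that the Lie brackets satisfy $[g_i,g_j](x)=\sum_{k=1}^m\gamma^{ij}_k g_k(x)$ for all $x\in B(x^*,3\gamma)$, $1\le i,j\le m$. $\mathcal{U}_a$ (admissible perturbations) is the set of all maps $u:[0,\infty)\times\mathbb{R}^n\to\square$, piecewise right-continuous in $t\ge0$, with $u(0,\lambda)=0$, $u(t,\cdot)\in C^1_b(\mathbb{R}^n;\mathbb{R}^m)$ and $|\partial_\lambda u_i(t,\lambda)|\le K_1$ for all $t\ge0$, $\lambda\in\mathbb{R}^n$, $1\le i\le m$. The intervals $[t_k,t_{k+1})\subseteq[0,T]$,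 $0\le k\le N-1$ ($0=t_0<\dots<t_N=T$), are the continuity intervals of $u$ in $t$. $A(p)=[b_1\ b_2(t_1)\ \dots\ b_m(t_1,\dots,t_{m-1})]$ is an $m\times m$ matrix with $C^\infty$ columns $b_j=(b_j^1,\dots,b_j^m)^{\top}$ on $\square$, $b_1=(1,0,\dots,0)^{\top}$, $A(0)=I_m$, giving the algebraic representation of the gradient system solved by $y=G(p)[\lambda]$: for $p\in\square$, $\lambda\in B(x^*,2\gamma)$, $\partial_{t_j}y=Y_j(t_1,\dots,t_{j-1};y)$ with $Y_j(t_1,\dots,t_{j-1};y)=\sum_{i=1}^m b_j^i(t_1,\dots,t_{j-1})g_i(y)$, $1\le j\le m$, $y(0)=\lambda$. (Such an $A$ is obtained from the involution hypothesis; it is fixed.) Define $$\alpha_{ij}^u(t,\lambda)=\int_0^t b_j^i(u_1(s,\lambda),\dots,u_{j-1}(s,\lambda))\,d_su_j(s,\lambda),\qquad \beta_i^u(t,\lambda)=\sum_{j=1}^m\alpha_{ij}^u(t,\lambda).$$ Norms: $|\cdot|$ is the Euclidean norm on vectors, and $|A|=\sum_{i,j}|A_{ij}|$ for the $m\times m$ matrix $A$. At $t=t_k$ time derivatives are one-sided (right) derivatives. *)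

theory Defs
  imports "HOL-Analysis.Analysis"
begin

text \<open>
  Conventions. The indices \<open>1, \<dots>, m\<close> are the elements, in increasing order, of a finite
  linearly ordered type \<open>'m\<close>, so \<open>m = CARD('m)\<close> and the index \<open>1\<close> is \<open>Min UNIV\<close>; the state
  space is \<open>real^'n\<close>. The parameter box is \<open>cbox (-a) a\<close> for \<open>a :: real^'m\<close>.
\<close>

section \<open>Smoothness, flows, brackets\<close>

text \<open>
  \<open>Ck_on k S f\<close> says that \<open>f\<close> is \<open>k\<close> times continuously differentiable on \<open>S\<close>. Derivatives are
  taken within \<open>S\<close>, hence one-sided at boundary points. It is only used for convex sets with
  nonempty interior, on which the derivative \<open>f'\<close> is unique.
\<close>

primrec Ck_on ::
  "nat \<Rightarrow> 'a::euclidean_space set \<Rightarrow> ('a \<Rightarrow> 'b::real_normed_vector) \<Rightarrow> bool" where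
  "Ck_on 0 S f \<longleftrightarrow> continuous_on S f"
| "Ck_on (Suc k) S f \<longleftrightarrow>
     (\<exists>f'. (\<forall>x\<in>S. (f has_derivative f' x) (at x within S)) \<and>
           (\<forall>v. Ck_on k S (\<lambda>x. f' x v)))"

definition smooth_on :: "'a::euclidean_space set \<Rightarrow> ('a \<Rightarrow> 'b::real_normed_vector) \<Rightarrow> bool" where
  "smooth_on S f \<longleftrightarrow> (\<forall>k. Ck_on k S f)"

definition C1_bounded :: "(real^'n \<Rightarrow> real^'m) \<Rightarrow> bool" where
  "C1_bounded f \<longleftrightarrow>
     Ck_on 1 UNIV f \<and> bounded (range f) \<and> bounded (range (\<lambda>x. jacobian f (at x)))"

text \<open>
  The existence of a flow defined for all times is the completeness of \<open>X\<close>; for smooth \<open>X\<close> the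
  flow is unique.
\<close>

definition is_flow :: "(real^'n \<Rightarrow> real^'n) \<Rightarrow> (real \<Rightarrow> real^'n \<Rightarrow> real^'n) \<Rightarrow> bool" where
  "is_flow X \<Phi> \<longleftrightarrow>
     (\<forall>x. \<Phi> 0 x = x \<and> (\<forall>t. ((\<lambda>s. \<Phi> s x) has_vector_derivative X (\<Phi> t x)) (at t)))"

text \<open>The opposite sign convention would not change the hypotheses in which the bracket occurs.\<close>

definition lie_bracket ::
  "(real^'n \<Rightarrow> real^'n) \<Rightarrow> (real^'n \<Rightarrow> real^'n) \<Rightarrow> real^'n \<Rightarrow> real^'n" where
  "lie_bracket X Y x = jacobian Y (at x) *v X x - jacobian X (at x) *v Y x"

definition real_involution_on ::
  "(real^'n) set \<Rightarrow> ('m::finite \<Rightarrow> real^'n \<Rightarrow> real^'n) \<Rightarrow> bool" where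
  "real_involution_on S g \<longleftrightarrow>
     (\<exists>c :: 'm \<Rightarrow> 'm \<Rightarrow> 'm \<Rightarrow> real. \<forall>i j. \<forall>x\<in>S.
        lie_bracket (g i) (g j) x = (\<Sum>k\<in>UNIV. c i j k *\<^sub>R g k x))"

section \<open>The composed flow and its algebraic representation\<close>

text \<open>\<open>G\<^sub>1(p\<^sub>1) \<circ> \<dots> \<circ> G\<^sub>m(p\<^sub>m)\<close> (the last factor acts first) and
  \<open>G\<^sub>m(-p\<^sub>m) \<circ> \<dots> \<circ> G\<^sub>1(-p\<^sub>1)\<close> (the first one acts first).\<close>

definition comp_flow ::
  "('m::{finite,linorder} \<Rightarrow> real \<Rightarrow> real^'n \<Rightarrow> real^'n) \<Rightarrow> (real, 'm) vec \<Rightarrow> real^'n \<Rightarrow> real^'n" where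
  "comp_flow G p x = foldr (\<lambda>i. G i (p $ i)) (sorted_list_of_set UNIV) x"

definition inv_comp_flow ::
  "('m::{finite,linorder} \<Rightarrow> real \<Rightarrow> real^'n \<Rightarrow> real^'n) \<Rightarrow> (real, 'm) vec \<Rightarrow> real^'n \<Rightarrow> real^'n" where
  "inv_comp_flow G p y = fold (\<lambda>i. G i (- (p $ i))) (sorted_list_of_set UNIV) y"

definition upd :: "real^'m \<Rightarrow> 'm \<Rightarrow> real \<Rightarrow> real^'m" where
  "upd p j s = (\<chi> k. if k = j then s else p $ k)"

text \<open>
  \<open>b j\<close> is the \<open>j\<close>-th column. As a function of \<open>t\<^sub>1, \<dots>, t\<^sub>j\<^sub>-\<^sub>1\<close> only, it is rendered as a function
  on the whole box that does not depend on the remaining coordinates.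
\<close>

definition rep_matrix :: "('m \<Rightarrow> real^'m \<Rightarrow> real^'m) \<Rightarrow> real^'m \<Rightarrow> real^'m^'m" where
  "rep_matrix b p = (\<chi> i j. b j p $ i)"

definition entry_norm :: "real^'m^'m \<Rightarrow> real" where
  "entry_norm A = (\<Sum>i\<in>UNIV. \<Sum>j\<in>UNIV. \<bar>A $ i $ j\<bar>)"

definition algebraic_representation ::
  "('m::{finite,linorder} \<Rightarrow> real^'n \<Rightarrow> real^'n) \<Rightarrow> ('m \<Rightarrow> real \<Rightarrow> real^'n \<Rightarrow> real^'n) \<Rightarrow>
   (real, 'm) vec \<Rightarrow> (real^'n) set \<Rightarrow> ('m \<Rightarrow> (real, 'm) vec \<Rightarrow> (real, 'm) vec) \<Rightarrow> bool" where
  "algebraic_representation g G a S b \<longleftrightarrow>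
     (\<forall>j. smooth_on (cbox (-a) a) (b j)) \<and>
     (\<forall>j. \<forall>p\<in>cbox (-a) a. \<forall>q\<in>cbox (-a) a. (\<forall>k<j. p $ k = q $ k) \<longrightarrow> b j p = b j q) \<and>
     (\<forall>p\<in>cbox (-a) a. b (Min UNIV) p = axis (Min UNIV) 1) \<and>
     rep_matrix b 0 = mat 1 \<and>
     (\<forall>l\<in>S. comp_flow G 0 l = l) \<and>
     (\<forall>p\<in>cbox (-a) a. \<forall>l\<in>S. \<forall>j.
        ((\<lambda>s. comp_flow G (upd p j s) l) has_vector_derivative
           (\<Sum>i\<in>UNIV. (b j p $ i) *\<^sub>R g i (comp_flow G p l))) (at (p $ j) within {- a $ j..a $ j}))"

section \<open>Admissible perturbations\<close>

definition continuity_partition ::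
  "(real \<Rightarrow> 'a \<Rightarrow> 'b::topological_space) \<Rightarrow> real \<Rightarrow> nat \<Rightarrow> (nat \<Rightarrow> real) \<Rightarrow> bool" where
  "continuity_partition u T N \<tau> \<longleftrightarrow>
     \<tau> 0 = 0 \<and> \<tau> N = T \<and> (\<forall>k<N. \<tau> k < \<tau> (Suc k)) \<and>
     (\<forall>k<N. \<forall>l. continuous_on {\<tau> k..<\<tau> (Suc k)} (\<lambda>t. u t l))"

definition piecewise_right_continuous ::
  "(real \<Rightarrow> 'a \<Rightarrow> 'b::topological_space) \<Rightarrow> bool" where
  "piecewise_right_continuous u \<longleftrightarrow> (\<forall>T>0. \<exists>N \<tau>. continuity_partition u T N \<tau>)"

text \<open>Perturbations are functions of \<open>t :: real\<close>, of which only the values for \<open>t \<ge> 0\<close> matter.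
  \<open>D\<close> is the gradient of \<open>u\<^sub>i(t,\<cdot>)\<close>.\<close>

definition admissible :: "real^'m \<Rightarrow> real \<Rightarrow> (real \<Rightarrow> real^'n \<Rightarrow> real^'m) \<Rightarrow> bool" where
  "admissible a K u \<longleftrightarrow>
     (\<forall>t\<ge>0. \<forall>l. u t l \<in> cbox (-a) a) \<and>
     piecewise_right_continuous u \<and>
     (\<forall>l. u 0 l = 0) \<and>
     (\<forall>t\<ge>0. C1_bounded (u t)) \<and>
     (\<forall>t\<ge>0. \<forall>l i. \<exists>D. GDERIV (\<lambda>l. u t l $ i) l :> D \<and> norm D \<le> K)"

definition bounded_variation_on :: "real \<Rightarrow> real \<Rightarrow> (real \<Rightarrow> real) \<Rightarrow> bool" where
  "bounded_variation_on c d h \<longleftrightarrow>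
     (\<exists>B. \<forall>(n::nat) s. mono s \<and> s 0 = c \<and> s n = d \<longrightarrow> (\<Sum>k<n. \<bar>h (s (Suc k)) - h (s k)\<bar>) \<le> B)"

section \<open>Stieltjes integrals\<close>

text \<open>
  \<open>h\<close> may jump at the same points, and from the same side, as the integrand \<open>f\<close>, so the
  integral is the Lebesgue--Stieltjes one, over \<open>{c<..d}\<close> and with respect to the signed measure
  of the right-continuous function \<open>h\<close> of bounded variation: \<open>h\<close> is written as the difference of
  nondecreasing right-continuous functions. The value does not depend on the decomposition.
\<close>

definition has_stieltjes_integral ::
  "(real \<Rightarrow> real) \<Rightarrow> (real \<Rightarrow> real) \<Rightarrow> real \<Rightarrow> real \<Rightarrow> real \<Rightarrow> bool" where
  "has_stieltjes_integral f h c d I \<longleftrightarrow>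
     (\<exists>P Q. mono P \<and> mono Q \<and>
        (\<forall>s. continuous (at_right s) P) \<and> (\<forall>s. continuous (at_right s) Q) \<and>
        (\<forall>s\<in>{c..d}. h s = P s - Q s) \<and>
        set_integrable (interval_measure P) {c<..d} f \<and>
        set_integrable (interval_measure Q) {c<..d} f \<and>
        I = (LINT s:{c<..d}|interval_measure P. f s) - (LINT s:{c<..d}|interval_measure Q. f s))"

definition stieltjes_integral ::
  "(real \<Rightarrow> real) \<Rightarrow> (real \<Rightarrow> real) \<Rightarrow> real \<Rightarrow> real \<Rightarrow> real" where
  "stieltjes_integral f h c d = (THE I. has_stieltjes_integral f h c d I)"

definition alpha ::
  "('m \<Rightarrow> real^'m \<Rightarrow> real^'m) \<Rightarrow> (real \<Rightarrow> real^'n \<Rightarrow> real^'m) \<Rightarrow> 'm \<Rightarrow> 'm \<Rightarrow> real \<Rightarrow> real^'n \<Rightarrow> real"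
  where
  "alpha b u i j t l = stieltjes_integral (\<lambda>s. b j (u s l) $ i) (\<lambda>s. u s l $ j) 0 t"

definition beta ::
  "('m \<Rightarrow> real^'m \<Rightarrow> real^'m) \<Rightarrow> (real \<Rightarrow> real^'n \<Rightarrow> real^'m) \<Rightarrow> 'm \<Rightarrow> real \<Rightarrow> real^'n \<Rightarrow> real" where
  "beta b u i t l = (\<Sum>j\<in>UNIV. alpha b u i j t l)"

section \<open>The solution of the implicit equation\<close>

definition solves ::
  "(real \<Rightarrow> real^'n \<Rightarrow> real^'n) \<Rightarrow> ('m::{finite,linorder} \<Rightarrow> real \<Rightarrow> real^'n \<Rightarrow> real^'n) \<Rightarrow>
   (real \<Rightarrow> real^'n \<Rightarrow> (real, 'm) vec) \<Rightarrow> (real^'n) set \<Rightarrow> real \<Rightarrow> real^'n \<Rightarrow> real^'n \<Rightarrow> bool" where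
  "solves G0 G u S t x l \<longleftrightarrow> l \<in> S \<and> G0 t (comp_flow G (u t l) l) = x"

definition psi ::
  "(real \<Rightarrow> real^'n \<Rightarrow> real^'n) \<Rightarrow> ('m::{finite,linorder} \<Rightarrow> real \<Rightarrow> real^'n \<Rightarrow> real^'n) \<Rightarrow>
   (real \<Rightarrow> real^'n \<Rightarrow> (real, 'm) vec) \<Rightarrow> (real^'n) set \<Rightarrow> real \<Rightarrow> real^'n \<Rightarrow> real^'n" where
  "psi G0 G u S t x = (THE l. solves G0 G u S t x l)"

end

theory Submission
  imports Defs
begin

text \<open>
  Write \<open>z(p;y)\<close> for \<open>inv_comp_flow G p y\<close>. Since flows form groups, the equation
  \<open>G\<^sub>0(t)[G(u(t,\<lambda>))[\<lambda>]] = x\<close> says exactly that \<open>\<lambda>\<close> is a fixed point of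
  \<open>\<lambda> \<mapsto> z(u(t,\<lambda>); G\<^sub>0(-t)[x])\<close>. Differentiating \<open>z(p;G(p)[\<lambda>]) = \<lambda>\<close> in \<open>p\<close> and inserting the
  algebraic representation expresses \<open>\<partial>\<^sub>p z\<close> through the vectors \<open>\<partial>\<^sub>y z \<cdot> g\<^sub>i(y)\<close> and the entries of
  \<open>A(p)\<close>, so the fixed-point map has Lipschitz constant at most \<open>C\<^sub>1 C\<^sub>2 K\<^sub>1 = \<rho> \<le> 1/2\<close>
  (\<open>perturbed_inverse_contraction\<close>). The displacement bounds keep \<open>G\<^sub>0(-t)[x]\<close> and all its images
  under \<open>z\<close> within distance \<open>3\<gamma>/2\<close> of the centre, where the representation holds. This gives
  existence and uniqueness of \<open>\<psi>(t,x)\<close>.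

  A fixed point of a uniform contraction depends differentiably on a parameter as soon as the
  contraction is differentiable at the one point considered (\<open>fixed_point_differentiable\<close>). Unlike
  the usual implicit function theorem this also works at the left end of a continuity interval of
  \<open>u\<close>, where only one-sided derivatives exist.

  For the equation itself put \<open>\<Theta>(t,\<lambda>) = G\<^sub>0(t)[G(u(t,\<lambda>))[\<lambda>]]\<close> and differentiate the identity
  \<open>\<Theta>(t,\<psi>(t,x)) = x\<close>. In \<open>x\<close> this yields \<open>\<partial>\<^sub>\<lambda>\<Theta> \<cdot> \<partial>\<^sub>x\<psi> = id\<close>, hence also \<open>\<partial>\<^sub>x\<psi> \<cdot> \<partial>\<^sub>\<lambda>\<Theta> = id\<close>; in \<open>t\<close> it yields
  \<open>\<partial>\<^sub>t\<Theta> + \<partial>\<^sub>\<lambda>\<Theta> \<cdot> \<partial>\<^sub>t\<psi> = 0\<close>. Together, \<open>\<partial>\<^sub>t\<psi> + \<partial>\<^sub>x\<psi> \<cdot> \<partial>\<^sub>t\<Theta> = 0\<close>. It remains to compute \<open>\<partial>\<^sub>t\<Theta>\<close> at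
  \<open>\<lambda> = \<psi>(t,x)\<close>. With \<open>y = G(u(t,\<lambda>))[\<lambda>]\<close> it equals
  \<open>g\<^sub>0(x) + \<partial>\<^sub>yG\<^sub>0(t)[y] \<cdot> \<Sum>\<^sub>j \<partial>\<^sub>tu\<^sub>j \<cdot> \<Sum>\<^sub>i b\<^sub>j\<^sup>i g\<^sub>i(y)\<close>. Because \<open>[g\<^sub>0,g\<^sub>i] = 0\<close> along the orbit from \<open>y\<close> to \<open>x\<close>,
  the flow of \<open>g\<^sub>0\<close> carries \<open>g\<^sub>i(y)\<close> to \<open>g\<^sub>i(x)\<close> (\<open>flow_maps_commuting_field\<close>), and
  \<open>\<Sum>\<^sub>j b\<^sub>j\<^sup>i \<partial>\<^sub>tu\<^sub>j\<close> is the time derivative of \<open>\<beta>\<^sub>i\<close> (\<open>beta_has_derivative\<close>).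

  Two bodies of theory support this. The first is the differentiable dependence of a flow on time and
  initial value, derived from the variational equation along an orbit by Gronwall estimates. The second
  is differentiation of a Lebesgue--Stieltjes integral in its upper limit: where the integrator \<open>h\<close> is
  Lipschitz, its total variation is Lipschitz with the same constant, so the integral over a short
  interval from \<open>t\<close> to \<open>s\<close> differs from \<open>f(t) (h(s) - h(t))\<close> by at most a constant times the length
  of the interval and the oscillation of the integrand \<open>f\<close> on it.
\<close>

section \<open>A Gronwall inequality and linear differential equations\<close>

text \<open>
  Since \<open>2\<epsilon>|w| \<le> |w|\<^sup>2 + \<epsilon>\<^sup>2\<close>, the function \<open>|w|\<^sup>2 + \<epsilon>\<^sup>2\<close> grows at most at the exponential rate
  \<open>2L + 1\<close>. Working with squares avoids differentiating the norm at zero; all applications only need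
  that \<open>|w(t)|\<close> is bounded by a constant times \<open>|w(0)|\<close> or \<open>\<epsilon>\<close>.
\<close>

lemma gronwall_norm:
  fixes w w' :: "real \<Rightarrow> 'a::real_inner"
  assumes L: "L \<ge> 0"
    and d: "\<And>s. s \<in> {0..T} \<Longrightarrow> (w has_vector_derivative w' s) (at s within {0..T})"
    and b: "\<And>s. s \<in> {0..T} \<Longrightarrow> norm (w' s) \<le> L * norm (w s) + \<epsilon>"
    and t: "t \<in> {0..T}"
  shows "(norm (w t))\<^sup>2 \<le> exp ((2 * L + 1) * t) * ((norm (w 0))\<^sup>2 + \<epsilon>\<^sup>2)"
proof -
  define f where "f s = exp (- (2 * L + 1) * s) * (w s \<bullet> w s + \<epsilon>\<^sup>2)" for s
  have der: "(f has_real_derivative exp (- (2 * L + 1) * s) *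
      (2 * (w s \<bullet> w' s) - (2 * L + 1) * (w s \<bullet> w s + \<epsilon>\<^sup>2))) (at s within {0..T})" if "s \<in> {0..T}" for s
  proof -
    have "((\<lambda>s. w s \<bullet> w s) has_derivative (\<lambda>h. w s \<bullet> (h *\<^sub>R w' s) + (h *\<^sub>R w' s) \<bullet> w s)) (at s within {0..T})"
      using d[OF that] by (auto intro!: derivative_eq_intros simp: has_vector_derivative_def)
    then have "((\<lambda>s. w s \<bullet> w s) has_real_derivative 2 * (w s \<bullet> w' s)) (at s within {0..T})"
      by (auto simp: has_field_derivative_def inner_commute algebra_simps mult_commute_abs
          elim!: has_derivative_eq_rhs)
    then show ?thesis
      unfolding f_def by (auto intro!: derivative_eq_intros simp: algebra_simps)
  qed
  \<comment> \<open>The weight in \<open>f\<close> is chosen so that this factor of its derivative is nonpositive.\<close>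
  have neg: "2 * (w s \<bullet> w' s) - (2 * L + 1) * (w s \<bullet> w s + \<epsilon>\<^sup>2) \<le> 0" if "s \<in> {0..T}" for s
  proof -
    have "w s \<bullet> w' s \<le> norm (w s) * norm (w' s)" by (rule norm_cauchy_schwarz)
    also have "\<dots> \<le> norm (w s) * (L * norm (w s) + \<epsilon>)"
      by (rule mult_left_mono[OF b[OF that(1)]]) auto
    finally have 1: "w s \<bullet> w' s \<le> L * (norm (w s))\<^sup>2 + norm (w s) * \<epsilon>"
      by (simp add: algebra_simps power2_eq_square)
    have 2: "2 * (norm (w s) * \<epsilon>) \<le> (norm (w s))\<^sup>2 + \<epsilon>\<^sup>2"
      using sum_squares_bound[of "norm (w s)" \<epsilon>] by (simp add: mult.assoc)
    have "2 * (L * \<epsilon>\<^sup>2) \<ge> 0" using L by simp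
    then show ?thesis
      using 1 2 by (simp add: dot_square_norm algebra_simps)
  qed
  have "f t \<le> f 0"
  proof (rule DERIV_nonpos_imp_decreasing_open[where f = f])
    show "0 \<le> t" using t by simp
    fix s assume s: "0 < s" "s < t"
    then have si: "s \<in> interior {0..T}" "s \<in> {0..T}" using t by auto
    show "\<exists>y. (f has_real_derivative y) (at s) \<and> y \<le> 0"
      using der[OF si(2)] mult_nonneg_nonpos[OF exp_ge_zero neg[OF si(2)]]
      unfolding at_within_interior[OF si(1)] by blast
  next
    have "continuous_on {0..T} f"
      by (rule DERIV_continuous_on[OF der])
    then show "continuous_on {0..t} f"
      by (rule continuous_on_subset) (use t in auto)
  qed
  then have "exp ((2 * L + 1) * t) * f t \<le> exp ((2 * L + 1) * t) * f 0" by simp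
  moreover have "exp ((2 * L + 1) * t) * f t = (norm (w t))\<^sup>2 + \<epsilon>\<^sup>2"
  proof -
    have "exp ((2 * L + 1) * t) * exp (- (2 * L + 1) * t) = 1"
      unfolding exp_add[symmetric] by (simp add: algebra_simps)
    then show ?thesis
      unfolding f_def mult.assoc[symmetric] by (simp add: dot_square_norm)
  qed
  moreover have "f 0 = (norm (w 0))\<^sup>2 + \<epsilon>\<^sup>2"
    by (simp add: f_def dot_square_norm)
  ultimately have "(norm (w t))\<^sup>2 + \<epsilon>\<^sup>2 \<le> exp ((2 * L + 1) * t) * ((norm (w 0))\<^sup>2 + \<epsilon>\<^sup>2)"
    by (simp only:)
  then show ?thesis
    using zero_le_power2[of \<epsilon>] by linarith
qed

text \<open>
  The Peano--Baker series: the iterated integrals \<open>X\<^sub>0 = id\<close>, \<open>X\<^sub>n\<^sub>+\<^sub>1(t) = \<integral>\<^sub>0\<^sup>t A X\<^sub>n\<close> satisfy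
  \<open>|X\<^sub>n(t)| \<le> (Mt)\<^sup>n / n!\<close>, so their sum converges uniformly together with its termwise derivative.
\<close>

lemma linear_ode_exists:
  fixes A :: "real \<Rightarrow> 'a::banach \<Rightarrow>\<^sub>L 'a"
  assumes A: "continuous_on {0..T} A" and T: "T \<ge> 0"
  obtains Z where "Z 0 = id_blinfun"
    "\<And>t. t \<in> {0..T} \<Longrightarrow> (Z has_vector_derivative (A t o\<^sub>L Z t)) (at t within {0..T})"
proof -
  obtain M where M: "\<And>t. t \<in> {0..T} \<Longrightarrow> norm (A t) \<le> M" "M \<ge> 0"
  proof -
    have "bounded (A ` {0..T})" using A by (intro compact_imp_bounded compact_continuous_image) auto
    then obtain M where "\<forall>t\<in>{0..T}. norm (A t) \<le> M" by (auto simp: bounded_iff)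
    then show ?thesis using that[of "max M 0"] by (meson max.cobounded2 max.coboundedI1)
  qed
  define X where "X = rec_nat (\<lambda>t. id_blinfun) (\<lambda>n Y t. integral {0..t} (\<lambda>s. A s o\<^sub>L Y s))"
  have X0: "X 0 = (\<lambda>t. id_blinfun)" and XS: "X (Suc n) = (\<lambda>t. integral {0..t} (\<lambda>s. A s o\<^sub>L X n s))" for n
    by (auto simp: X_def)
  define X' where "X' n t = (case n of 0 \<Rightarrow> 0 | Suc k \<Rightarrow> A t o\<^sub>L X k t)" for n t
  have cont: "continuous_on {0..T} (X n)"
    and der: "\<And>t. t \<in> {0..T} \<Longrightarrow> (X n has_vector_derivative X' n t) (at t within {0..T})" for n
  proof (induction n)
    case (Suc n)
    have *: "continuous_on {0..T} (\<lambda>s. A s o\<^sub>L X n s)"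
      by (intro continuous_intros A Suc)
    show d: "(X (Suc n) has_vector_derivative X' (Suc n) t) (at t within {0..T})" if "t \<in> {0..T}" for t
      unfolding XS X'_def using integral_has_vector_derivative[OF * that] by simp
    then show "continuous_on {0..T} (X (Suc n))"
      by (rule continuous_on_vector_derivative)
  qed (auto simp: X0 X'_def)
  have bound: "norm (X n t) \<le> (M * t) ^ n / fact n" if "t \<in> {0..T}" for n t
    using that
  proof (induction n arbitrary: t)
    case 0
    then show ?case by (simp add: X0 norm_blinfun_id_le)
  next
    case (Suc n)
    show ?case
    proof (cases "t = 0")
      case False
      with Suc have t: "t > 0" by auto
      have "norm (X (Suc n) t - X (Suc n) 0) \<le> (M * t) ^ Suc n / fact (Suc n) - (M * 0) ^ Suc n / fact (Suc n)"
      proof (rule differentiable_bound_general[OF t])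
        show "continuous_on {0..t} (X (Suc n))"
          by (rule continuous_on_subset[OF cont]) (use Suc in auto)
        show "continuous_on {0..t} (\<lambda>t. (M * t) ^ Suc n / fact (Suc n))"
          by (intro continuous_intros) auto
        fix s assume s: "0 < s" "s < t"
        then have si: "s \<in> interior {0..T}" "s \<in> {0..T}" using Suc.prems by auto
        show "(X (Suc n) has_vector_derivative X' (Suc n) s) (at s)"
          using der[OF si(2)] unfolding at_within_interior[OF si(1)] .
        have "((\<lambda>t. (M * t) ^ Suc n / fact (Suc n)) has_real_derivative
            (1 + of_nat n) * (M * (M * s) ^ n) / fact (Suc n)) (at s)"
          by (intro DERIV_cdivide DERIV_power_Suc DERIV_cmult_Id)
        also have "(1 + of_nat n) * (M * (M * s) ^ n) / fact (Suc n) = M * ((M * s) ^ n / fact n)"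
        proof -
          have "(fact (Suc n) :: real) = (1 + of_nat n) * fact n" by simp
          then show ?thesis by (simp only:) (simp add: field_simps add_nonneg_eq_0_iff)
        qed
        finally show "((\<lambda>t. (M * t) ^ Suc n / fact (Suc n)) has_vector_derivative
            M * ((M * s) ^ n / fact n)) (at s)"
          by (simp add: has_real_derivative_iff_has_vector_derivative)
        have "norm (X' (Suc n) s) \<le> norm (A s) * norm (X n s)"
          by (simp add: X'_def norm_blinfun_compose)
        also have "\<dots> \<le> M * ((M * s) ^ n / fact n)"
          by (intro mult_mono M Suc.IH si) auto
        finally show "norm (X' (Suc n) s) \<le> M * ((M * s) ^ n / fact n)" .
      qed
      then show ?thesis by (simp add: XS)
    qed (auto simp: XS)
  qed
  have bound': "norm (X n t) \<le> (M * T) ^ n / fact n" if "t \<in> {0..T}" for n t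
  proof (rule order_trans[OF bound[OF that]])
    show "(M * t) ^ n / fact n \<le> (M * T) ^ n / fact n"
      using that M by (intro divide_right_mono power_mono mult_left_mono) auto
  qed
  have summable: "summable (\<lambda>n. (M * T) ^ n / fact n)"
    using summable_exp[of "M * T"] by (simp add: field_simps)
  define Z where "Z t = (\<Sum>n. X n t)" for t
  have unif: "uniform_limit {0..T} (\<lambda>n t. \<Sum>i<n. X i t) Z sequentially"
    unfolding Z_def by (rule Weierstrass_m_test[OF bound' summable]) auto
  have sums: "(\<lambda>n. X n t) sums Z t" if "t \<in> {0..T}" for t
    unfolding Z_def
    by (rule summable_sums, rule summable_comparison_test'[OF summable, of 0]) (rule bound'[OF that])
  have shift: "(\<Sum>i<Suc n. X' i t) = A t o\<^sub>L (\<Sum>i<n. X i t)" for n t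
  proof (induction n)
    case (Suc n)
    then show ?case
      by (simp add: X'_def bounded_bilinear.add_right[OF bounded_bilinear_blinfun_compose])
  qed (simp add: X'_def)
  have "\<exists>g. \<forall>t\<in>{0..T}. (\<lambda>n. X n t) sums g t \<and>
      (g has_derivative (\<lambda>h. h *\<^sub>R (A t o\<^sub>L Z t))) (at t within {0..T})"
  proof (rule has_derivative_series[where f' = "\<lambda>n t h. h *\<^sub>R X' n t"])
    show "(X n has_derivative (\<lambda>h. h *\<^sub>R X' n t)) (at t within {0..T})" if "t \<in> {0..T}" for n t
      using der[OF that] by (simp add: has_vector_derivative_def)
    show "0 \<in> {0..T}" "(\<lambda>n. X n 0) sums Z 0" using T sums by auto
    fix e :: real assume e: "e > 0"
    define e' where "e' = e / (M + 1)"
    have "e' > 0" using e M by (simp add: e'_def)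
    then have "\<forall>\<^sub>F n in sequentially. \<forall>t\<in>{0..T}. dist (\<Sum>i<n. X i t) (Z t) < e'"
      using unif by (simp add: uniform_limit_iff)
    then have "\<forall>\<^sub>F n in sequentially. \<forall>t\<in>{0..T}. norm ((\<Sum>i<Suc n. X' i t) - (A t o\<^sub>L Z t)) \<le> e"
    proof eventually_elim
      case (elim n)
      show ?case
      proof
        fix t assume t: "t \<in> {0..T}"
        have "(\<Sum>i<Suc n. X' i t) - (A t o\<^sub>L Z t) = A t o\<^sub>L ((\<Sum>i<n. X i t) - Z t)"
          unfolding shift by (simp add: bounded_bilinear.diff_right[OF bounded_bilinear_blinfun_compose])
        also have "norm \<dots> \<le> norm (A t) * norm ((\<Sum>i<n. X i t) - Z t)"
          by (rule norm_blinfun_compose)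
        also have "\<dots> \<le> M * e'"
          using elim t M by (intro mult_mono) (auto simp: dist_norm less_imp_le)
        also have "\<dots> \<le> e" using M e by (simp add: e'_def field_simps)
        finally show "norm ((\<Sum>i<Suc n. X' i t) - (A t o\<^sub>L Z t)) \<le> e" .
      qed
    qed
    then have "\<forall>\<^sub>F n in sequentially. \<forall>t\<in>{0..T}. norm ((\<Sum>i<n. X' i t) - (A t o\<^sub>L Z t)) \<le> e"
      by (subst eventually_sequentially_Suc[symmetric])
    then show "\<forall>\<^sub>F n in sequentially. \<forall>t\<in>{0..T}. \<forall>h.
        norm ((\<Sum>i<n. h *\<^sub>R X' i t) - h *\<^sub>R (A t o\<^sub>L Z t)) \<le> e * norm h"
    proof eventually_elim
      case (elim n)
      show ?case
      proof (intro ballI allI)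
        fix t h assume "t \<in> {0..T}"
        then have "\<bar>h\<bar> * norm ((\<Sum>i<n. X' i t) - (A t o\<^sub>L Z t)) \<le> \<bar>h\<bar> * e"
          using elim by (intro mult_left_mono) auto
        then show "norm ((\<Sum>i<n. h *\<^sub>R X' i t) - h *\<^sub>R (A t o\<^sub>L Z t)) \<le> e * norm h"
          by (simp add: scaleR_sum_right[symmetric] scaleR_diff_right[symmetric] mult.commute)
      qed
    qed
  qed auto
  then obtain g where g: "\<And>t. t \<in> {0..T} \<Longrightarrow> (\<lambda>n. X n t) sums g t"
      "\<And>t. t \<in> {0..T} \<Longrightarrow> (g has_derivative (\<lambda>h. h *\<^sub>R (A t o\<^sub>L Z t))) (at t within {0..T})" by blast
  have gZ: "g t = Z t" if "t \<in> {0..T}" for t using sums_unique2[OF g(1) sums] that by auto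
  have "g 0 = id_blinfun"
  proof -
    have "(\<lambda>n. X n 0) = (\<lambda>n. if n = 0 then id_blinfun else 0)"
      by (rule ext) (auto simp: X0 XS gr0_conv_Suc split: nat.splits)
    then have "(\<lambda>n. X n 0) sums id_blinfun" using sums_single[of 0 "\<lambda>_. id_blinfun"] by simp
    then show ?thesis using g(1)[of 0] T sums_unique2 by fastforce
  qed
  moreover have "(g has_vector_derivative (A t o\<^sub>L g t)) (at t within {0..T})" if "t \<in> {0..T}" for t
    using g(2)[OF that] gZ[OF that] by (simp add: has_vector_derivative_def)
  ultimately show ?thesis using that by blast
qed

section \<open>Flows of continuously differentiable vector fields\<close>

text \<open>
  The derivative of the field is given as a map into bounded linear functions, so that its continuity
  is continuity in the operator norm, which the uniform estimates along orbits require.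
\<close>

locale C1_flow =
  fixes X :: "'a::euclidean_space \<Rightarrow> 'a" and DX :: "'a \<Rightarrow> 'a \<Rightarrow>\<^sub>L 'a" and \<Phi> :: "real \<Rightarrow> 'a \<Rightarrow> 'a"
  assumes field_derivative: "\<And>x. (X has_derivative blinfun_apply (DX x)) (at x)"
    and field_derivative_continuous: "continuous_on UNIV DX"
    and flow_0: "\<And>x. \<Phi> 0 x = x"
    and flow_derivative: "\<And>x t. ((\<lambda>s. \<Phi> s x) has_vector_derivative X (\<Phi> t x)) (at t)"
begin

text \<open>
  Estimates are proved for nonnegative times; this transports them to negative times.
\<close>

lemma reversed: "C1_flow (\<lambda>x. - X x) (\<lambda>x. - DX x) (\<lambda>t. \<Phi> (- t))"
proof
  show "((\<lambda>x. - X x) has_derivative blinfun_apply (- DX x)) (at x)" for x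
    using has_derivative_minus[OF field_derivative[of x]] by (simp add: uminus_blinfun.rep_eq)
  show "continuous_on UNIV (\<lambda>x. - DX x)"
    by (intro continuous_intros field_derivative_continuous)
  show "((\<lambda>s. \<Phi> (- s) x) has_vector_derivative - X (\<Phi> (- t) x)) (at t)" for x t
  proof -
    have "(uminus has_vector_derivative -1) (at t)" for t :: real
      by (auto intro!: derivative_eq_intros)
    from vector_diff_chain_at[OF this flow_derivative] show ?thesis
      by (simp add: o_def)
  qed
qed (simp add: flow_0)

lemma field_lipschitz:
  obtains L where "L \<ge> 0" "\<And>p. p \<in> cball 0 R \<Longrightarrow> norm (DX p) \<le> L"
    "\<And>p q. p \<in> cball 0 R \<Longrightarrow> q \<in> cball 0 R \<Longrightarrow> norm (X p - X q) \<le> L * norm (p - q)"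
proof -
  have "bounded (DX ` cball 0 R)"
    by (intro compact_imp_bounded compact_continuous_image compact_cball
        continuous_on_subset[OF field_derivative_continuous]) auto
  then obtain L0 where L0: "\<And>p. p \<in> cball 0 R \<Longrightarrow> norm (DX p) \<le> L0" unfolding bounded_iff by blast
  define L where "L = max L0 0"
  have L: "L \<ge> 0" "\<And>p. p \<in> cball 0 R \<Longrightarrow> norm (DX p) \<le> L"
    using L0 by (auto simp: L_def le_max_iff_disj)
  have "norm (X p - X q) \<le> L * norm (p - q)" if "p \<in> cball 0 R" "q \<in> cball 0 R" for p q
  proof (rule differentiable_bound[OF convex_cball _ _ that])
    show "(X has_derivative blinfun_apply (DX x)) (at x within cball 0 R)" for x
      by (rule has_derivative_at_withinI[OF field_derivative])
    show "onorm (blinfun_apply (DX x)) \<le> L" if "x \<in> cball 0 R" for x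
      using L(2)[OF that] by (simp add: norm_blinfun.rep_eq)
  qed
  with L show ?thesis using that by blast
qed

lemma continuous_on_orbit: "continuous_on S (\<lambda>s. \<Phi> s x)"
  by (rule continuous_on_vector_derivative[OF has_vector_derivative_at_within[OF flow_derivative]])

lemma orbit_bounded:
  obtains R where "\<And>s. s \<in> {0..T} \<Longrightarrow> norm (\<Phi> s x) \<le> R"
proof -
  have "bounded ((\<lambda>s. \<Phi> s x) ` {0..T})"
    by (intro compact_imp_bounded compact_continuous_image continuous_on_orbit) auto
  then show ?thesis using that unfolding bounded_iff by blast
qed

lemma forward_unique:
  assumes c: "\<And>s. (c has_vector_derivative X (c s)) (at s)" and T: "T \<ge> 0"
  shows "c T = \<Phi> T (c 0)"
proof -
  have cont: "continuous_on {0..T} c"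
    by (rule continuous_on_vector_derivative[OF has_vector_derivative_at_within[OF c]])
  have "bounded (c ` {0..T})"
    by (intro compact_imp_bounded compact_continuous_image cont) auto
  then obtain R1 where R1: "\<And>s. s \<in> {0..T} \<Longrightarrow> norm (c s) \<le> R1" unfolding bounded_iff by blast
  obtain R2 where R2: "\<And>s. s \<in> {0..T} \<Longrightarrow> norm (\<Phi> s (c 0)) \<le> R2" using orbit_bounded by blast
  obtain L where L: "L \<ge> 0"
    "\<And>p q. p \<in> cball 0 (max R1 R2) \<Longrightarrow> q \<in> cball 0 (max R1 R2) \<Longrightarrow> norm (X p - X q) \<le> L * norm (p - q)"
    using field_lipschitz by metis
  have "(norm (c T - \<Phi> T (c 0)))\<^sup>2 \<le> exp ((2 * L + 1) * T) * ((norm (c 0 - \<Phi> 0 (c 0)))\<^sup>2 + 0\<^sup>2)"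
  proof (rule gronwall_norm[OF L(1), where w = "\<lambda>s. c s - \<Phi> s (c 0)"])
    show "((\<lambda>s. c s - \<Phi> s (c 0)) has_vector_derivative X (c s) - X (\<Phi> s (c 0))) (at s within {0..T})" for s
      by (intro has_vector_derivative_diff has_vector_derivative_at_within[OF c]
          has_vector_derivative_at_within[OF flow_derivative])
    show "norm (X (c s) - X (\<Phi> s (c 0))) \<le> L * norm (c s - \<Phi> s (c 0)) + 0" if "s \<in> {0..T}" for s
      using L(2)[of "c s" "\<Phi> s (c 0)"] R1[OF that] R2[OF that] by (simp add: le_max_iff_disj)
  qed (use T in auto)
  then show ?thesis by (simp add: flow_0)
qed

lemma unique:
  assumes c: "\<And>s. (c has_vector_derivative X (c s)) (at s)"
  shows "c T = \<Phi> T (c 0)"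
proof (cases "T \<ge> 0")
  case True
  then show ?thesis using forward_unique c by blast
next
  case False
  interpret rev: C1_flow "\<lambda>x. - X x" "\<lambda>x. - DX x" "\<lambda>t. \<Phi> (- t)" by (rule reversed)
  have "((\<lambda>s. c (- s)) has_vector_derivative - X (c (- s))) (at s)" for s
  proof -
    have "(uminus has_vector_derivative -1) (at t)" for t :: real
      by (auto intro!: derivative_eq_intros)
    from vector_diff_chain_at[OF this c] show ?thesis
      by (simp add: o_def)
  qed
  from rev.forward_unique[OF this, of "- T"] False show ?thesis by simp
qed

lemma flow_add: "\<Phi> (s + t) x = \<Phi> s (\<Phi> t x)"
proof -
  have "((\<lambda>s. \<Phi> (s + t) x) has_vector_derivative X (\<Phi> (s + t) x)) (at s)" for s
  proof -
    have "((\<lambda>s. s + t) has_vector_derivative 1) (at s)"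
      by (auto intro!: derivative_eq_intros)
    from vector_diff_chain_at[OF this flow_derivative] show ?thesis
      by (simp add: o_def)
  qed
  from unique[OF this, of s] show ?thesis by simp
qed

lemma flow_inverse: "\<Phi> (- t) (\<Phi> t x) = x" "\<Phi> t (\<Phi> (- t) x) = x"
  using flow_add[of "- t" t x] flow_add[of t "- t" x] by (auto simp: flow_0)

text \<open>
  As long as two orbits stay within distance one of each other, a Lipschitz constant of the field on a
  fixed ball and Gronwall's inequality bound their distance by \<open>C\<close> times the initial distance. If the
  initial distance is below \<open>1/C\<close>, the orbits can therefore never separate to distance one.
\<close>

lemma flow_lipschitz:
  assumes T: "T \<ge> 0"
  obtains \<delta> C where "\<delta> > 0" "C > 0"
    "\<And>y t. norm (y - x) < \<delta> \<Longrightarrow> t \<in> {0..T} \<Longrightarrow> norm (\<Phi> t y - \<Phi> t x) \<le> C * norm (y - x)"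
proof -
  obtain R where R: "\<And>s. s \<in> {0..T} \<Longrightarrow> norm (\<Phi> s x) \<le> R" using orbit_bounded by blast
  obtain L where L: "L \<ge> 0"
    "\<And>p q. p \<in> cball 0 (R + 1) \<Longrightarrow> q \<in> cball 0 (R + 1) \<Longrightarrow> norm (X p - X q) \<le> L * norm (p - q)"
    using field_lipschitz by metis
  define C where "C = sqrt (exp ((2 * L + 1) * T))"
  have C: "C > 0" "C\<^sup>2 = exp ((2 * L + 1) * T)" by (auto simp: C_def)
  \<comment> \<open>The a priori bound: it presupposes that the orbits stay close up to time \<open>S\<close>.\<close>
  have growth: "norm (\<Phi> t y - \<Phi> t x) \<le> C * norm (y - x)"
    if S: "S \<le> T" and close: "\<And>s. s \<in> {0..S} \<Longrightarrow> norm (\<Phi> s y - \<Phi> s x) \<le> 1" and t: "t \<in> {0..S}" for y S t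
  proof -
    have "(norm (\<Phi> t y - \<Phi> t x))\<^sup>2 \<le> exp ((2 * L + 1) * t) * ((norm (\<Phi> 0 y - \<Phi> 0 x))\<^sup>2 + 0\<^sup>2)"
    proof (rule gronwall_norm[OF L(1) _ _ t, where w = "\<lambda>s. \<Phi> s y - \<Phi> s x"])
      show "((\<lambda>s. \<Phi> s y - \<Phi> s x) has_vector_derivative X (\<Phi> s y) - X (\<Phi> s x)) (at s within {0..S})" for s
        by (intro has_vector_derivative_diff has_vector_derivative_at_within[OF flow_derivative])
      show "norm (X (\<Phi> s y) - X (\<Phi> s x)) \<le> L * norm (\<Phi> s y - \<Phi> s x) + 0" if s: "s \<in> {0..S}" for s
      proof -
        have "norm (\<Phi> s x) \<le> R" using R s S by auto
        moreover have "norm (\<Phi> s y) \<le> R + 1"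
          using norm_triangle_sub[of "\<Phi> s y" "\<Phi> s x"] close[OF s] calculation by simp
        ultimately show ?thesis using L(2) by simp
      qed
    qed
    also have "\<dots> \<le> exp ((2 * L + 1) * T) * (norm (y - x))\<^sup>2"
      using L(1) S t by (auto simp: flow_0 intro!: mult_right_mono mult_left_mono)
    also have "\<dots> = (C * norm (y - x))\<^sup>2" by (simp add: C power_mult_distrib)
    finally show ?thesis by (rule power2_le_imp_le) (use C in auto)
  qed
  have inside: "norm (\<Phi> t y - \<Phi> t x) < 1" if y: "norm (y - x) < 1 / C" "norm (y - x) < 1" and t: "t \<in> {0..T}" for y t
  proof (rule ccontr)
    assume far: "\<not> ?thesis"
    define d where "d s = norm (\<Phi> s y - \<Phi> s x)" for s
    have d: "continuous_on S d" for S
      unfolding d_def by (intro continuous_intros continuous_on_orbit)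
    have d0: "d 0 < 1" using y by (simp add: d_def flow_0)
    \<comment> \<open>The first time at which the orbits are at distance one contradicts the a priori bound.\<close>
    define Z where "Z = {s \<in> {0..T}. 1 \<le> d s}"
    have "closed Z"
      unfolding Z_def by (intro continuous_on_closed_Collect_le d continuous_intros)
    moreover have "bounded Z" by (rule bounded_subset[of "{0..T}"]) (auto simp: Z_def)
    moreover have "t \<in> Z" using far t by (simp add: Z_def d_def)
    ultimately obtain s0 where s0: "s0 \<in> Z" "\<And>s. s \<in> Z \<Longrightarrow> s0 \<le> s"
      using compact_attains_inf[of Z] by (auto simp: compact_eq_bounded_closed)
    have "\<exists>r\<ge>0. r \<le> s0 \<and> d r = 1"
    proof (rule IVT')
      show "d 0 \<le> 1" "1 \<le> d s0" "0 \<le> s0" using d0 s0(1) by (auto simp: Z_def)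
    qed (rule d)
    then obtain r where "0 \<le> r" "r \<le> s0" "d r = 1" by blast
    moreover have "s0 \<le> T" using s0(1) by (simp add: Z_def)
    ultimately have "r \<in> Z" by (simp add: Z_def)
    with s0(2) \<open>r \<le> s0\<close> \<open>d r = 1\<close> have "d s0 = 1" by (metis order_antisym)
    have "d s \<le> 1" if s: "s \<in> {0..s0}" for s
    proof (rule ccontr)
      assume "\<not> d s \<le> 1"
      with s \<open>s0 \<le> T\<close> have "s \<in> Z" by (simp add: Z_def)
      with s0(2) s have "s = s0" by (simp add: order_antisym)
      with \<open>d s0 = 1\<close> \<open>\<not> d s \<le> 1\<close> show False by simp
    qed
    then have "norm (\<Phi> s y - \<Phi> s x) \<le> 1" if "s \<in> {0..s0}" for s
      using that by (simp add: d_def)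
    from growth[OF _ this, of s0 s0] s0(1) have "d s0 \<le> C * norm (y - x)"
      by (simp add: Z_def d_def)
    also have "\<dots> < 1" using y(1) C(1) by (simp add: field_simps)
    finally show False using \<open>d s0 = 1\<close> by simp
  qed
  show ?thesis
  proof (rule that[of "min 1 (1 / C)" C])
    show "norm (\<Phi> t y - \<Phi> t x) \<le> C * norm (y - x)" if "norm (y - x) < min 1 (1 / C)" "t \<in> {0..T}" for y t
      by (rule growth[of T]) (use inside that in \<open>auto intro: less_imp_le\<close>)
  qed (use C in auto)
qed

text \<open>
  The solution \<open>Z\<close> of the linearised equation along the orbit is the derivative of the flow: the
  remainder \<open>\<Phi>\<^sub>t(y) - \<Phi>\<^sub>t(x) - Z(t)(y - x)\<close> solves the linearised equation up to the linearisation
  error of the field, which is \<open>o(|y - x|)\<close> uniformly on \<open>[0,T]\<close>, and it vanishes at time zero.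
\<close>

lemma variational_equation:
  assumes T: "T \<ge> 0"
  obtains Z where "Z 0 = id_blinfun"
    "\<And>t. t \<in> {0..T} \<Longrightarrow> (\<Phi> t has_derivative blinfun_apply (Z t)) (at x)"
    "\<And>t. t \<in> {0..T} \<Longrightarrow> (Z has_vector_derivative (DX (\<Phi> t x) o\<^sub>L Z t)) (at t within {0..T})"
proof -
  have "continuous_on {0..T} (\<lambda>t. DX (\<Phi> t x))"
    by (rule continuous_on_compose2[OF field_derivative_continuous continuous_on_orbit]) auto
  then obtain Z where Z: "Z 0 = id_blinfun"
    "\<And>t. t \<in> {0..T} \<Longrightarrow> (Z has_vector_derivative (DX (\<Phi> t x) o\<^sub>L Z t)) (at t within {0..T})"
    by (rule linear_ode_exists[OF _ T]) blast
  obtain R where R: "\<And>s. s \<in> {0..T} \<Longrightarrow> norm (\<Phi> s x) \<le> R" using orbit_bounded by blast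
  obtain M where M: "M \<ge> 0" "\<And>p. p \<in> cball 0 R \<Longrightarrow> norm (DX p) \<le> M"
    using field_lipschitz by metis
  obtain \<delta> C where \<delta>: "\<delta> > 0" and C: "C > 0"
    and lip: "\<And>y t. norm (y - x) < \<delta> \<Longrightarrow> t \<in> {0..T} \<Longrightarrow> norm (\<Phi> t y - \<Phi> t x) \<le> C * norm (y - x)"
    using flow_lipschitz[OF T] by metis
  have "uniformly_continuous_on (cball 0 (R + 1)) DX"
    by (intro compact_uniformly_continuous continuous_on_subset[OF field_derivative_continuous]) auto
  note uc = this[unfolded uniformly_continuous_on_def, rule_format]
  have "(\<Phi> t has_derivative blinfun_apply (Z t)) (at x)" if t: "t \<in> {0..T}" for t
    unfolding has_derivative_at_alt
  proof (intro conjI allI impI)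
    show "bounded_linear (blinfun_apply (Z t))" by (rule blinfun.bounded_linear_right)
    fix e :: real assume e: "e > 0"
    define E where "E = sqrt (exp ((2 * M + 1) * T))"
    have E: "E > 0" "E\<^sup>2 = exp ((2 * M + 1) * T)" by (auto simp: E_def)
    \<comment> \<open>Gronwall turns a linearisation error of size \<open>e1 \<cdot> C \<cdot> |y - x|\<close> into \<open>E\<close> times that.\<close>
    define e1 where "e1 = e / (C * E)"
    have e1: "e1 > 0" using e C E by (simp add: e1_def)
    obtain \<eta> where \<eta>: "\<eta> > 0"
      "\<And>p q. p \<in> cball 0 (R + 1) \<Longrightarrow> q \<in> cball 0 (R + 1) \<Longrightarrow> dist q p < \<eta> \<Longrightarrow> dist (DX q) (DX p) < e1"
      using uc[OF e1] by blast
    define \<eta>' where "\<eta>' = min \<eta> 1"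
    have \<eta>': "\<eta>' > 0" "\<eta>' \<le> \<eta>" "\<eta>' \<le> 1" using \<eta> by (auto simp: \<eta>'_def)
    show "\<exists>d>0. \<forall>y. norm (y - x) < d \<longrightarrow> norm (\<Phi> t y - \<Phi> t x - blinfun_apply (Z t) (y - x)) \<le> e * norm (y - x)"
    proof (intro exI conjI allI impI)
      show "min \<delta> (\<eta>' / C) > 0" using \<delta> \<eta>' C by simp
      fix y assume y: "norm (y - x) < min \<delta> (\<eta>' / C)"
      have near: "norm (\<Phi> s y - \<Phi> s x) \<le> C * norm (y - x)" "norm (\<Phi> s y - \<Phi> s x) < \<eta>'"
        if "s \<in> {0..T}" for s
      proof -
        show "norm (\<Phi> s y - \<Phi> s x) \<le> C * norm (y - x)" using lip y that by simp
        also have "\<dots> < \<eta>'" using y C by (simp add: field_simps)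
        finally show "norm (\<Phi> s y - \<Phi> s x) < \<eta>'" .
      qed
      \<comment> \<open>The oscillation of \<open>DX\<close> on a small ball around the orbit point is below \<open>e1\<close>.\<close>
      have lin: "norm (X (\<Phi> s y) - X (\<Phi> s x) - DX (\<Phi> s x) (\<Phi> s y - \<Phi> s x)) \<le> norm (\<Phi> s y - \<Phi> s x) * e1"
        if s: "s \<in> {0..T}" for s
      proof (rule differentiable_bound_linearization[where S = "ball (\<Phi> s x) \<eta>'"
            and f' = "\<lambda>p. blinfun_apply (DX p)"])
        show "\<Phi> s x \<in> ball (\<Phi> s x) \<eta>'" using \<eta>' by simp
        show "\<Phi> s x + r *\<^sub>R (\<Phi> s y - \<Phi> s x) \<in> ball (\<Phi> s x) \<eta>'" if "r \<in> {0..1}" for r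
        proof -
          have "norm (r *\<^sub>R (\<Phi> s y - \<Phi> s x)) \<le> 1 * norm (\<Phi> s y - \<Phi> s x)"
            unfolding norm_scaleR using that by (intro mult_right_mono) auto
          then show ?thesis using near(2)[OF s] by (simp add: dist_norm)
        qed
        show "(X has_derivative blinfun_apply (DX p)) (at p within ball (\<Phi> s x) \<eta>')" for p
          by (rule has_derivative_at_withinI[OF field_derivative])
        show "onorm (blinfun_apply (DX p) - blinfun_apply (DX (\<Phi> s x))) \<le> e1"
          if p: "p \<in> ball (\<Phi> s x) \<eta>'" for p
        proof -
          have "norm p \<le> norm (\<Phi> s x) + norm (p - \<Phi> s x)" by (rule norm_triangle_sub)
          then have "p \<in> cball 0 (R + 1)"
            using p \<eta>'(3) R[OF s] by (simp add: dist_norm norm_minus_commute)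
          moreover have "\<Phi> s x \<in> cball 0 (R + 1)" using R[OF s] by simp
          moreover have "dist p (\<Phi> s x) < \<eta>" using p \<eta>'(2) by (simp add: dist_commute)
          ultimately have "dist (DX p) (DX (\<Phi> s x)) < e1" using \<eta>(2) by blast
          then show ?thesis by (simp add: dist_norm norm_blinfun.rep_eq minus_blinfun.rep_eq fun_diff_def)
        qed
      qed
      define \<epsilon> where "\<epsilon> = C * norm (y - x) * e1"
      have "(norm (\<Phi> t y - \<Phi> t x - Z t (y - x)))\<^sup>2
          \<le> exp ((2 * M + 1) * t) * ((norm (\<Phi> 0 y - \<Phi> 0 x - Z 0 (y - x)))\<^sup>2 + \<epsilon>\<^sup>2)"
      proof (rule gronwall_norm[OF M(1) _ _ t, where w = "\<lambda>s. \<Phi> s y - \<Phi> s x - Z s (y - x)"])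
        fix s assume s: "s \<in> {0..T}"
        have "((\<lambda>s. Z s (y - x)) has_vector_derivative DX (\<Phi> s x) (Z s (y - x))) (at s within {0..T})"
          using bounded_linear.has_vector_derivative[OF blinfun.bounded_linear_left Z(2)[OF s], of "y - x"] by simp
        then show "((\<lambda>s. \<Phi> s y - \<Phi> s x - Z s (y - x)) has_vector_derivative
            X (\<Phi> s y) - X (\<Phi> s x) - DX (\<Phi> s x) (Z s (y - x))) (at s within {0..T})"
          by (intro has_vector_derivative_diff has_vector_derivative_at_within[OF flow_derivative])
        let ?w = "\<Phi> s y - \<Phi> s x - Z s (y - x)"
        have "X (\<Phi> s y) - X (\<Phi> s x) - DX (\<Phi> s x) (Z s (y - x)) =
            DX (\<Phi> s x) ?w + (X (\<Phi> s y) - X (\<Phi> s x) - DX (\<Phi> s x) (\<Phi> s y - \<Phi> s x))"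
          by (simp add: blinfun.diff_right)
        also have "norm \<dots> \<le> norm (DX (\<Phi> s x)) * norm ?w + norm (\<Phi> s y - \<Phi> s x) * e1"
          by (intro norm_triangle_le add_mono norm_blinfun lin s)
        also have "\<dots> \<le> M * norm ?w + \<epsilon>"
          unfolding \<epsilon>_def using e1 near(1)[OF s] R[OF s]
          by (intro add_mono mult_right_mono M(2)) auto
        finally show "norm (X (\<Phi> s y) - X (\<Phi> s x) - DX (\<Phi> s x) (Z s (y - x))) \<le> M * norm ?w + \<epsilon>" .
      qed
      also have "\<dots> \<le> exp ((2 * M + 1) * T) * \<epsilon>\<^sup>2"
        using M(1) t by (auto simp: flow_0 Z(1) intro!: mult_right_mono mult_left_mono)
      also have "\<dots> = (E * \<epsilon>)\<^sup>2" by (simp add: E power_mult_distrib)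
      finally have "norm (\<Phi> t y - \<Phi> t x - Z t (y - x)) \<le> E * \<epsilon>"
        by (rule power2_le_imp_le) (use E C e1 in \<open>auto simp: \<epsilon>_def\<close>)
      also have "\<dots> = e * norm (y - x)" using E C by (simp add: \<epsilon>_def e1_def)
      finally show "norm (\<Phi> t y - \<Phi> t x - blinfun_apply (Z t) (y - x)) \<le> e * norm (y - x)" .
    qed
  qed
  then show ?thesis using that Z by blast
qed

lemma flow_differentiable: "\<Phi> t differentiable (at x)"
proof (cases "t \<ge> 0")
  case True
  then show ?thesis using variational_equation[of t x] by (metis differentiableI atLeastAtMost_iff order_refl)
next
  case False
  interpret rev: C1_flow "\<lambda>x. - X x" "\<lambda>x. - DX x" "\<lambda>t. \<Phi> (- t)" by (rule reversed)
  from False show ?thesis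
    using rev.variational_equation[of "- t" x]
    by (metis differentiableI atLeastAtMost_iff order_refl linear neg_0_le_iff_le minus_minus)
qed

lemma flow_jointly_continuous: "continuous (at (x, t)) (\<lambda>(x, t). \<Phi> t x)"
proof -
  define T where "T = \<bar>t\<bar> + 1"
  have T: "T \<ge> 0" by (simp add: T_def)
  interpret rev: C1_flow "\<lambda>x. - X x" "\<lambda>x. - DX x" "\<lambda>t. \<Phi> (- t)" by (rule reversed)
  obtain \<delta>1 C1 where 1: "\<delta>1 > 0" "C1 > 0"
    "\<And>y t. norm (y - x) < \<delta>1 \<Longrightarrow> t \<in> {0..T} \<Longrightarrow> norm (\<Phi> t y - \<Phi> t x) \<le> C1 * norm (y - x)"
    using flow_lipschitz[OF T] by metis
  obtain \<delta>2 C2 where 2: "\<delta>2 > 0" "C2 > 0"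
    "\<And>y t. norm (y - x) < \<delta>2 \<Longrightarrow> t \<in> {0..T} \<Longrightarrow> norm (\<Phi> (- t) y - \<Phi> (- t) x) \<le> C2 * norm (y - x)"
    using rev.flow_lipschitz[OF T] by metis
  have both: "norm (\<Phi> s y - \<Phi> s x) \<le> (C1 + C2) * norm (y - x)"
    if "norm (y - x) < min \<delta>1 \<delta>2" "\<bar>s\<bar> \<le> T" for y s
  proof (cases "s \<ge> 0")
    case True
    then have "norm (\<Phi> s y - \<Phi> s x) \<le> C1 * norm (y - x)" using 1(3) that by auto
    also have "\<dots> \<le> (C1 + C2) * norm (y - x)" using 2 by (intro mult_right_mono) auto
    finally show ?thesis .
  next
    case False
    then have "norm (\<Phi> s y - \<Phi> s x) \<le> C2 * norm (y - x)" using 2(3)[of y "- s"] that by auto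
    also have "\<dots> \<le> (C1 + C2) * norm (y - x)" using 1 by (intro mult_right_mono) auto
    finally show ?thesis .
  qed
  have "((\<lambda>p. \<Phi> (snd p) (fst p) - \<Phi> (snd p) x) \<longlongrightarrow> 0) (at (x, t))"
  proof (rule Lim_null_comparison)
    have "\<forall>\<^sub>F p in at (x, t). p \<in> ball x (min \<delta>1 \<delta>2) \<times> ball t 1"
      by (rule eventually_at_in_open') (use 1 2 in \<open>auto intro!: open_Times\<close>)
    then show "\<forall>\<^sub>F p in at (x, t). norm (\<Phi> (snd p) (fst p) - \<Phi> (snd p) x) \<le> (C1 + C2) * norm (fst p - x)"
    proof eventually_elim
      case (elim p)
      then have "norm (fst p - x) < min \<delta>1 \<delta>2" "\<bar>snd p\<bar> \<le> T"
        by (auto simp: dist_norm norm_minus_commute T_def mem_Times_iff)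
      then show ?case by (rule both)
    qed
    have "continuous (at (x, t)) (\<lambda>p. (C1 + C2) * norm (fst p - x))" by (intro continuous_intros)
    then show "((\<lambda>p. (C1 + C2) * norm (fst p - x)) \<longlongrightarrow> 0) (at (x, t))"
      by (simp add: continuous_at)
  qed
  moreover have "((\<lambda>p. \<Phi> (snd p) x) \<longlongrightarrow> \<Phi> t x) (at (x, t))"
  proof -
    have "isCont (\<lambda>s. \<Phi> s x) t"
      using continuous_on_orbit[of UNIV x] by (simp add: continuous_on_eq_continuous_at)
    then have "isCont (\<lambda>p. \<Phi> (snd p) x) (x, t)"
      by (intro isCont_o2[where f = snd and g = "\<lambda>s. \<Phi> s x"]) auto
    then show ?thesis by (simp add: continuous_at)
  qed
  ultimately have "((\<lambda>p. \<Phi> (snd p) (fst p) - \<Phi> (snd p) x + \<Phi> (snd p) x) \<longlongrightarrow> 0 + \<Phi> t x) (at (x, t))"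
    by (rule tendsto_add)
  then show ?thesis by (simp add: continuous_at case_prod_unfold)
qed

text \<open>
  Differentiability in \<open>x\<close> at the point and a jointly continuous partial derivative
  \<open>\<partial>\<^sub>t\<Phi> = X(\<Phi>)\<close> suffice for joint differentiability.
\<close>

lemma flow_jointly_differentiable: "(\<lambda>(t, x). \<Phi> t x) differentiable (at (t, x))"
proof -
  obtain D where D: "(\<Phi> t has_derivative D) (at x)"
    using flow_differentiable by (auto simp: differentiable_def)
  have "((\<lambda>(x, t). \<Phi> t x) has_derivative
      (\<lambda>(h, s). D h + blinfun_scaleR_left (X (\<Phi> t x)) s)) (at (x, t) within UNIV \<times> UNIV)"
  proof (rule has_derivative_partialsI)
    show "((\<lambda>y. \<Phi> t y) has_derivative D) (at x within UNIV)" using D by simp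
    show "((\<lambda>t. \<Phi> t y) has_derivative blinfun_scaleR_left (X (\<Phi> s y))) (at s within UNIV)" for y s
      using flow_derivative[of y s] by (simp add: has_vector_derivative_def)
    have "isCont (\<lambda>p. X (case p of (x, t) \<Rightarrow> \<Phi> t x)) (x, t)"
      by (rule isCont_o2[OF flow_jointly_continuous has_derivative_continuous[OF field_derivative]])
    then have "isCont (\<lambda>p. blinfun_scaleR_left (X (case p of (x, t) \<Rightarrow> \<Phi> t x))) (x, t)"
      by (rule bounded_linear.isCont[OF bounded_linear_blinfun_scaleR_left])
    then show "continuous (at (x, t) within UNIV \<times> UNIV) (\<lambda>(x, t). blinfun_scaleR_left (X (\<Phi> t x)))"
      by (simp add: case_prod_unfold)
  qed auto
  then have *: "(\<lambda>(x, t). \<Phi> t x) differentiable (at (x, t))" by (auto simp: differentiable_def)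
  have swap: "prod.swap differentiable (at (t, x))"
    by (rule bounded_linear_imp_differentiable) (auto simp: prod.swap_def[abs_def] intro!: bounded_linear_intros)
  have "((\<lambda>(x, t). \<Phi> t x) \<circ> prod.swap) differentiable (at (t, x))"
    by (rule differentiable_chain_at[OF swap]) (use * in simp)
  then show ?thesis by (simp add: o_def case_prod_unfold)
qed

end

text \<open>
  In finite dimension, continuity of the derivative in every fixed direction is continuity in the
  operator norm.
\<close>

lemma smooth_flow_C1_flow:
  assumes X: "smooth_on UNIV X" and \<Phi>: "is_flow X \<Phi>"
  obtains DX where "C1_flow X DX \<Phi>"
proof -
  have "Ck_on (Suc 0) UNIV X" using X by (simp add: smooth_on_def)
  then obtain X' where X': "\<And>x. (X has_derivative X' x) (at x)" "\<And>v. continuous_on UNIV (\<lambda>x. X' x v)"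
    by auto
  define DX where "DX x = Blinfun (X' x)" for x
  have DX: "blinfun_apply (DX x) = X' x" for x
    unfolding DX_def by (rule bounded_linear_Blinfun_apply[OF has_derivative_bounded_linear[OF X'(1)]])
  have "C1_flow X DX \<Phi>"
  proof
    show "(X has_derivative blinfun_apply (DX x)) (at x)" for x using X'(1) by (simp add: DX)
    show "continuous_on UNIV DX"
      by (rule continuous_on_blinfun_componentwise) (simp add: DX X'(2))
  qed (use \<Phi> in \<open>auto simp: is_flow_def\<close>)
  then show ?thesis by (rule that)
qed

section \<open>Invariance of commuting vector fields under the flow\<close>

text \<open>
  If \<open>[X,Y] = 0\<close> along the orbit of \<open>y\<close>, then \<open>D\<Phi>\<^sub>s(y) \<cdot> Y(y)\<close> and \<open>Y(\<Phi>\<^sub>s(y))\<close> both solve the linearised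
  equation along the orbit and agree at \<open>s = 0\<close>, so their difference vanishes by Gronwall's inequality.
\<close>

lemma (in C1_flow) flow_maps_commuting_field:
  fixes Y :: "'a \<Rightarrow> 'a"
  assumes Y: "\<And>y. (Y has_derivative DY y) (at y)"
    and t: "t \<ge> 0"
    and commute: "\<And>s. s \<in> {0..t} \<Longrightarrow> DY (\<Phi> s y) (X (\<Phi> s y)) = DX (\<Phi> s y) (Y (\<Phi> s y))"
    and D: "(\<Phi> t has_derivative D) (at y)"
  shows "D (Y y) = Y (\<Phi> t y)"
proof -
  obtain Z where Z: "Z 0 = id_blinfun" "\<And>s. s \<in> {0..t} \<Longrightarrow> (\<Phi> s has_derivative blinfun_apply (Z s)) (at y)"
    "\<And>s. s \<in> {0..t} \<Longrightarrow> (Z has_vector_derivative (DX (\<Phi> s y) o\<^sub>L Z s)) (at s within {0..t})"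
    by (rule variational_equation[OF t, of y]) blast
  obtain R where R: "\<And>s. s \<in> {0..t} \<Longrightarrow> norm (\<Phi> s y) \<le> R" using orbit_bounded by blast
  obtain M where M: "M \<ge> 0" "\<And>p. p \<in> cball 0 R \<Longrightarrow> norm (DX p) \<le> M"
    by (rule field_lipschitz[of R]) blast
  define w where "w s = Z s (Y y) - Y (\<Phi> s y)" for s
  have "(norm (w t))\<^sup>2 \<le> exp ((2 * M + 1) * t) * ((norm (w 0))\<^sup>2 + 0\<^sup>2)"
  proof (rule gronwall_norm[OF M(1)])
    fix s assume s: "s \<in> {0..t}"
    have "((\<lambda>s. Z s (Y y)) has_vector_derivative DX (\<Phi> s y) (Z s (Y y))) (at s within {0..t})"
      using bounded_linear.has_vector_derivative[OF blinfun.bounded_linear_left Z(3)[OF s], of "Y y"] by simp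
    moreover have "((\<lambda>s. Y (\<Phi> s y)) has_vector_derivative DY (\<Phi> s y) (X (\<Phi> s y))) (at s within {0..t})"
      using vector_derivative_diff_chain_within[OF has_vector_derivative_at_within[OF flow_derivative]
          has_derivative_at_withinI[OF Y]] by (simp add: o_def)
    ultimately show "(w has_vector_derivative DX (\<Phi> s y) (w s)) (at s within {0..t})"
      unfolding w_def[abs_def] commute[OF s] blinfun.diff_right by (rule has_vector_derivative_diff)
    show "norm (DX (\<Phi> s y) (w s)) \<le> M * norm (w s) + 0"
      using order_trans[OF norm_blinfun mult_right_mono[OF M(2)]] R[OF s] by simp
  qed (use t in auto)
  then have "Z t (Y y) = Y (\<Phi> t y)"
    by (simp add: w_def Z(1) flow_0)
  moreover have "D = blinfun_apply (Z t)" using has_derivative_unique[OF D Z(2)] t by simp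
  ultimately show ?thesis by simp
qed

section \<open>Fixed points of parametrised contractions\<close>

text \<open>
  Write \<open>A\<close> and \<open>B\<close> for the partial derivatives of \<open>F\<close> at \<open>(q\<^sub>0, \<phi>(q\<^sub>0))\<close>. The contraction property gives
  \<open>|B| \<le> c < 1\<close>, so \<open>I - B\<close> is invertible. It also makes \<open>\<phi>\<close> Lipschitz at \<open>q\<^sub>0\<close>, which turns the
  linearisation error of \<open>F\<close> into \<open>o(|q - q\<^sub>0|)\<close>; hence \<open>\<phi>\<close> has the derivative \<open>(I - B)\<^sup>-\<^sup>1 A\<close> within \<open>D\<close>.
  All estimates stay within \<open>D\<close>, which may thus be an interval containing its left endpoint.
\<close>

lemma fixed_point_differentiable:
  fixes F :: "'p::real_normed_vector \<times> 'e::euclidean_space \<Rightarrow> 'e" and \<phi> :: "'p \<Rightarrow> 'e"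
  assumes fixed: "\<And>q. q \<in> D \<Longrightarrow> F (q, \<phi> q) = \<phi> q"
    and contr: "\<And>q a b. q \<in> D \<Longrightarrow> norm (F (q, a) - F (q, b)) \<le> c * norm (a - b)" and c: "c < 1"
    and diff: "F differentiable (at (q0, \<phi> q0) within D \<times> UNIV)" and q0: "q0 \<in> D"
  shows "\<phi> differentiable (at q0 within D)"
proof -
  obtain F' where F': "(F has_derivative F') (at (q0, \<phi> q0) within D \<times> UNIV)"
    using diff by (auto simp: differentiable_def)
  interpret F': bounded_linear F' by (rule has_derivative_bounded_linear[OF F'])
  obtain K0 where K0: "\<And>z. norm (F' z) \<le> norm z * K0" "K0 \<ge> 0" using F'.nonneg_bounded by blast
  define \<phi>0 where "\<phi>0 = \<phi> q0"
  have approx: "\<exists>d>0. \<forall>q\<in>D. \<forall>e. norm (q - q0, e - \<phi>0) < d \<longrightarrow>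
      norm (F (q, e) - \<phi>0 - F' (q - q0, e - \<phi>0)) \<le> \<epsilon> * norm (q - q0, e - \<phi>0)" if "\<epsilon> > 0" for \<epsilon>
    using F' that unfolding has_derivative_within_alt \<phi>0_def[symmetric]
    by (auto simp: fixed[OF q0, folded \<phi>0_def])
  have B: "norm (F' (0, e)) \<le> c * norm e" for e
  proof (rule field_le_epsilon)
    fix \<epsilon> :: real assume \<epsilon>: "\<epsilon> > 0"
    define \<epsilon>' where "\<epsilon>' = \<epsilon> / (norm e + 1)"
    have \<epsilon>': "\<epsilon>' > 0" using \<epsilon> by (simp add: \<epsilon>'_def add_nonneg_pos)
    obtain d where d: "d > 0" "\<And>q x. q \<in> D \<Longrightarrow> norm (q - q0, x - \<phi>0) < d \<Longrightarrow>
      norm (F (q, x) - \<phi>0 - F' (q - q0, x - \<phi>0)) \<le> \<epsilon>' * norm (q - q0, x - \<phi>0)"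
      using approx[OF \<epsilon>'] by blast
    define r where "r = d / (2 * (norm e + 1))"
    have r: "r > 0" "r * norm e < d"
    proof -
      show "r > 0" using d by (simp add: r_def add_nonneg_pos)
      have "r * norm e < r * (2 * (norm e + 1))" using \<open>r > 0\<close> by (intro mult_strict_left_mono) (auto simp: add_nonneg_pos)
      also have "\<dots> = d" using norm_ge_zero[of e] unfolding r_def by (simp add: add_nonneg_eq_0_iff)
      finally show "r * norm e < d" .
    qed
    have "norm (F (q0, \<phi>0 + r *\<^sub>R e) - \<phi>0 - F' (0, r *\<^sub>R e)) \<le> \<epsilon>' * (r * norm e)"
      using d(2)[OF q0, of "\<phi>0 + r *\<^sub>R e"] r by (simp add: norm_Pair)
    moreover have "norm (F (q0, \<phi>0 + r *\<^sub>R e) - \<phi>0) \<le> c * (r * norm e)"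
      using contr[OF q0, of "\<phi>0 + r *\<^sub>R e" \<phi>0] fixed[OF q0] r by (simp add: \<phi>0_def)
    moreover have "norm (F' (0, r *\<^sub>R e)) \<le> norm (F (q0, \<phi>0 + r *\<^sub>R e) - \<phi>0)
        + norm (F (q0, \<phi>0 + r *\<^sub>R e) - \<phi>0 - F' (0, r *\<^sub>R e))"
      by norm
    ultimately have "norm (F' (0, r *\<^sub>R e)) \<le> c * (r * norm e) + \<epsilon>' * (r * norm e)"
      by linarith
    moreover have "F' (0, r *\<^sub>R e) = r *\<^sub>R F' (0, e)"
      using F'.scaleR[of r "(0, e)"] by simp
    ultimately have "r * norm (F' (0, e)) \<le> r * (c * norm e + \<epsilon>' * norm e)"
      using r(1) by (simp add: algebra_simps)
    then have "norm (F' (0, e)) \<le> c * norm e + \<epsilon>' * norm e"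
      using r(1) by (simp only: mult_le_cancel_left_pos)
    moreover have "\<epsilon>' * norm e \<le> \<epsilon>" 
    proof -
      have "norm e + 1 > 0" by (simp add: add_nonneg_pos)
      then show ?thesis using \<epsilon> by (simp add: \<epsilon>'_def pos_divide_le_eq)
    qed
    ultimately show "norm (F' (0, e)) \<le> c * norm e + \<epsilon>" by linarith
  qed
  define N where "N e = e - F' (0, e)" for e
  have "linear N"
  proof (rule linearI)
    show "N (x + y) = N x + N y" for x y
      using F'.add[of "(0, x)" "(0, y)"] by (simp add: N_def)
    show "N (r *\<^sub>R x) = r *\<^sub>R N x" for r x
      using F'.scaleR[of r "(0, x)"] by (simp add: N_def scaleR_diff_right)
  qed
  moreover have "inj N"
    unfolding linear_injective_0[OF \<open>linear N\<close>]
  proof (intro allI impI)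
    fix e assume "N e = 0"
    then have "norm e \<le> c * norm e" using B[of e] by (simp add: N_def)
    then have "(1 - c) * norm e \<le> 0" by (simp add: algebra_simps)
    then show "e = 0" using c by (simp add: mult_le_0_iff)
  qed
  ultimately obtain I where I: "linear I" "I \<circ> N = id" using linear_injective_left_inverse by blast
  have IN: "I (N e) = e" for e using I(2) by (metis comp_apply id_apply)
  have "bounded_linear I" using I(1) by (simp add: linear_conv_bounded_linear)
  interpret I: bounded_linear I by fact
  obtain KI where KI: "\<And>z. norm (I z) \<le> norm z * KI" "KI > 0" using I.pos_bounded by blast
  obtain d1 where d1: "d1 > 0" "\<And>q e. q \<in> D \<Longrightarrow> norm (q - q0, e - \<phi>0) < d1 \<Longrightarrow>
      norm (F (q, e) - \<phi>0 - F' (q - q0, e - \<phi>0)) \<le> 1 * norm (q - q0, e - \<phi>0)"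
    using approx[of 1] zero_less_one by blast
  \<comment> \<open>From \<open>|\<Delta>\<phi>| \<le> c|\<Delta>\<phi>| + (K\<^sub>0 + 1)|\<Delta>q|\<close>, the last term bounding the change of \<open>F(\<cdot>, \<phi>(q\<^sub>0))\<close>.\<close>
  define C where "C = (K0 + 1) / (1 - c)"
  have C: "C \<ge> 0" using K0 c by (simp add: C_def)
  have lip: "norm (\<phi> q - \<phi>0) \<le> C * norm (q - q0)" if q: "q \<in> D" "norm (q - q0) < d1" for q
  proof -
    have "norm (F (q, \<phi>0) - \<phi>0 - F' (q - q0, 0)) \<le> norm (q - q0)"
      using d1(2)[OF q(1), of \<phi>0] q(2) by (simp add: norm_Pair)
    moreover have "norm (F' (q - q0, 0)) \<le> norm (q - q0) * K0"
      using K0(1)[of "(q - q0, 0)"] by (simp add: norm_Pair)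
    moreover have "norm (\<phi> q - F (q, \<phi>0)) \<le> c * norm (\<phi> q - \<phi>0)"
      using contr[OF q(1), of "\<phi> q" \<phi>0] fixed[OF q(1)] by simp
    moreover have "norm (\<phi> q - \<phi>0) \<le> norm (\<phi> q - F (q, \<phi>0))
        + norm (F (q, \<phi>0) - \<phi>0 - F' (q - q0, 0)) + norm (F' (q - q0, 0))"
      by norm
    ultimately have "norm (\<phi> q - \<phi>0) \<le> c * norm (\<phi> q - \<phi>0) + (norm (q - q0) * K0 + norm (q - q0))"
      by linarith
    then have "(1 - c) * norm (\<phi> q - \<phi>0) \<le> (K0 + 1) * norm (q - q0)"
      by (simp add: algebra_simps)
    then show ?thesis using c by (simp add: C_def field_simps)
  qed
  have "(\<phi> has_derivative (\<lambda>h. I (F' (h, 0)))) (at q0 within D)"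
    unfolding has_derivative_within_alt
  proof (intro conjI allI impI)
    have "bounded_linear (\<lambda>h. (h, 0) :: 'p \<times> 'e)" by (intro bounded_linear_intros)
    then show "bounded_linear (\<lambda>h. I (F' (h, 0)))"
      by (intro bounded_linear_compose[OF I.bounded_linear_axioms] bounded_linear_compose[OF F'.bounded_linear_axioms])
    fix e :: real assume e: "e > 0"
    define e' where "e' = e / (KI * (1 + C))"
    have e': "e' > 0" using e KI C by (simp add: e'_def)
    obtain d2 where d2: "d2 > 0" "\<And>q x. q \<in> D \<Longrightarrow> norm (q - q0, x - \<phi>0) < d2 \<Longrightarrow>
      norm (F (q, x) - \<phi>0 - F' (q - q0, x - \<phi>0)) \<le> e' * norm (q - q0, x - \<phi>0)"
      using approx[OF e'] by blast
    show "\<exists>d>0. \<forall>q\<in>D. norm (q - q0) < d \<longrightarrow>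
        norm (\<phi> q - \<phi> q0 - I (F' (q - q0, 0))) \<le> e * norm (q - q0)"
    proof (intro exI conjI ballI impI)
      show "min d1 (d2 / (1 + C)) > 0" using d1 d2 C by simp
      fix q assume q: "q \<in> D" "norm (q - q0) < min d1 (d2 / (1 + C))"
      have "norm (q - q0, \<phi> q - \<phi>0) \<le> norm (q - q0) + C * norm (q - q0)"
        using norm_Pair_le[of "q - q0" "\<phi> q - \<phi>0"] lip[OF q(1)] q(2) by simp
      then have n: "norm (q - q0, \<phi> q - \<phi>0) \<le> (1 + C) * norm (q - q0)" by (simp add: algebra_simps)
      also have "\<dots> < d2" using q(2) C by (simp add: field_simps)
      finally have "norm (F (q, \<phi> q) - \<phi>0 - F' (q - q0, \<phi> q - \<phi>0)) \<le> e' * norm (q - q0, \<phi> q - \<phi>0)"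
        by (rule d2(2)[OF q(1)])
      also have "\<dots> \<le> e' * ((1 + C) * norm (q - q0))"
        using e' n by (intro mult_left_mono) auto
      finally have 1: "norm (\<phi> q - \<phi>0 - F' (q - q0, \<phi> q - \<phi>0)) \<le> e' * ((1 + C) * norm (q - q0))"
        using fixed[OF q(1)] by simp
      have "F' (q - q0, \<phi> q - \<phi>0) = F' (q - q0, 0) + F' (0, \<phi> q - \<phi>0)"
        using F'.add[of "(q - q0, 0)" "(0, \<phi> q - \<phi>0)"] by simp
      then have "\<phi> q - \<phi>0 - F' (q - q0, \<phi> q - \<phi>0) = N (\<phi> q - \<phi>0) - F' (q - q0, 0)"
        by (simp add: N_def)
      then have "\<phi> q - \<phi>0 - I (F' (q - q0, 0)) = I (\<phi> q - \<phi>0 - F' (q - q0, \<phi> q - \<phi>0))"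
        by (simp add: I.diff IN)
      also have "norm \<dots> \<le> e' * ((1 + C) * norm (q - q0)) * KI"
        using order_trans[OF KI(1) mult_right_mono[OF 1]] KI(2) by simp
      also have "\<dots> = e * norm (q - q0)" using KI C by (simp add: e'_def)
      finally show "norm (\<phi> q - \<phi> q0 - I (F' (q - q0, 0))) \<le> e * norm (q - q0)"
        by (simp add: \<phi>0_def)
    qed
  qed
  then show ?thesis by (auto simp: differentiable_def)
qed

section \<open>Composed flows and their parameter derivatives\<close>

lemma jacobian_mult_eq:
  fixes f :: "real^'n \<Rightarrow> real^'m"
  assumes "(f has_derivative f') (at x)"
  shows "jacobian f (at x) *v v = f' v"
proof -
  have "(f has_derivative (\<lambda>h. jacobian f (at x) *v h)) (at x)"
    using assms jacobian_works by (blast intro: differentiableI)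
  then show ?thesis using has_derivative_unique[OF _ assms] by metis
qed

lemma differentiable_Pair:
  assumes "f differentiable (at x within S)" "g differentiable (at x within S)"
  shows "(\<lambda>x. (f x, g x)) differentiable (at x within S)"
proof -
  from assms obtain f' g' where "(f has_derivative f') (at x within S)" "(g has_derivative g') (at x within S)"
    by (auto simp: differentiable_def)
  from has_derivative_Pair[OF this] show ?thesis by (rule differentiableI)
qed

lemma inv_comp_flow_comp_flow:
  assumes "\<And>i t x. G i (- t) (G i t x) = x"
  shows "inv_comp_flow G p (comp_flow G p x) = x"
proof -
  have "fold (\<lambda>i. G i (- (p $ i))) is (foldr (\<lambda>i. G i (p $ i)) is x) = x" for "is"
    by (induction "is") (auto simp: assms)
  then show ?thesis by (simp add: inv_comp_flow_def comp_flow_def)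
qed

lemma comp_flow_inv_comp_flow:
  assumes "\<And>i t x. G i t (G i (- t) x) = x"
  shows "comp_flow G p (inv_comp_flow G p x) = x"
proof -
  have "foldr (\<lambda>i. G i (p $ i)) is (fold (\<lambda>i. G i (- (p $ i))) is x) = x" for "is"
    by (induction "is" arbitrary: x) (auto simp: assms)
  then show ?thesis by (simp add: inv_comp_flow_def comp_flow_def)
qed

lemma comp_flow_jointly_differentiable:
  fixes G :: "'m::{finite,linorder} \<Rightarrow> real \<Rightarrow> real^'n \<Rightarrow> real^'n"
  assumes G: "\<And>i t x. (\<lambda>(t, x). G i t x) differentiable (at (t, x))"
  shows "(\<lambda>(p, x). comp_flow G p x) differentiable (at (p, x))"
proof -
  have "(\<lambda>z. foldr (\<lambda>i. G i (fst z $ i)) is (snd z)) differentiable (at (p, x))" for "is"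
  proof (induction "is")
    case (Cons i "is")
    have "(\<lambda>z. (fst z $ i, foldr (\<lambda>i. G i (fst z $ i)) is (snd z))) differentiable (at (p, x))"
    proof -
      have "(\<lambda>z :: (real, 'm) vec \<times> (real, 'n) vec. fst z $ i) differentiable (at (p, x))"
        by (intro bounded_linear_imp_differentiable
            bounded_linear_compose[OF bounded_linear_vec_nth bounded_linear_fst])
      with Cons show ?thesis
        by (intro differentiable_Pair)
    qed
    from differentiable_chain_at[OF this G[unfolded case_prod_unfold]] show ?case
      by (simp add: o_def)
  qed (simp add: bounded_linear_imp_differentiable bounded_linear_snd)
  then show ?thesis by (simp add: comp_flow_def case_prod_unfold)
qed

lemma inv_comp_flow_jointly_differentiable:
  fixes G :: "'m::{finite,linorder} \<Rightarrow> real \<Rightarrow> real^'n \<Rightarrow> real^'n"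
  assumes G: "\<And>i t x. (\<lambda>(t, x). G i t x) differentiable (at (t, x))"
  shows "(\<lambda>(p, x). inv_comp_flow G p x) differentiable (at (p, x))"
proof -
  have "(\<lambda>z. fold (\<lambda>i. G i (- (fst z $ i))) is (snd z)) differentiable (at (p, x))" for "is"
  proof (induction "is" rule: rev_induct)
    case (snoc i "is")
    have "(\<lambda>z. (- (fst z $ i), fold (\<lambda>i. G i (- (fst z $ i))) is (snd z))) differentiable (at (p, x))"
    proof -
      have "(\<lambda>z :: (real, 'm) vec \<times> (real, 'n) vec. - (fst z $ i)) differentiable (at (p, x))"
        by (intro bounded_linear_imp_differentiable bounded_linear_minus
            bounded_linear_compose[OF bounded_linear_vec_nth bounded_linear_fst])
      with snoc show ?thesis
        by (intro differentiable_Pair)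
    qed
    from differentiable_chain_at[OF this G[unfolded case_prod_unfold]] show ?case
      by (simp add: o_def)
  qed (simp add: bounded_linear_imp_differentiable bounded_linear_snd)
  then show ?thesis by (simp add: inv_comp_flow_def case_prod_unfold)
qed

text \<open>
  Each of the \<open>m\<close> flows moves its argument by at most \<open>d\<close>; the room assumed around \<open>y\<close> guarantees that
  every intermediate point still lies in the ball where this bound is available.
\<close>

lemma inv_comp_flow_displacement:
  fixes G :: "'m::{finite,linorder} \<Rightarrow> real \<Rightarrow> real^'n \<Rightarrow> real^'n"
  assumes move: "\<And>x i t. x \<in> cball z R \<Longrightarrow> \<bar>t\<bar> \<le> a $ i \<Longrightarrow> norm (G i t x - x) \<le> d"
    and p: "p \<in> cbox (- a) a" and y: "dist z y + real CARD('m) * d \<le> R" and d: "d \<ge> 0"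
  shows "norm (inv_comp_flow G p y - y) \<le> real CARD('m) * d"
proof -
  have "norm (fold (\<lambda>i. G i (- (p $ i))) is y - y) \<le> real (length is) * d"
    if "dist z y + real (length is) * d \<le> R" for "is" y
    using that
  proof (induction "is" arbitrary: y)
    case (Cons i "is")
    have "real (length is) * d \<ge> 0" using d by simp
    moreover have "dist z y + (d + real (length is) * d) \<le> R"
      using Cons.prems by (simp add: distrib_right)
    ultimately have "dist z y \<le> R" using d by linarith
    moreover have "\<bar>- (p $ i)\<bar> \<le> a $ i"
      using p by (auto simp: mem_box_cart abs_le_iff dest!: spec[of _ i])
    ultimately have step: "norm (G i (- (p $ i)) y - y) \<le> d" by (intro move) auto
    have "dist z (G i (- (p $ i)) y) \<le> dist z y + d"
      using dist_triangle[of z "G i (- (p $ i)) y" y] step by (simp add: dist_norm norm_minus_commute)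
    then have "norm (fold (\<lambda>i. G i (- (p $ i))) is (G i (- (p $ i)) y) - G i (- (p $ i)) y) \<le> real (length is) * d"
      using Cons.prems by (intro Cons.IH) (simp add: algebra_simps)
    moreover have "norm (v - y) \<le> norm (v - G i (- (p $ i)) y) + norm (G i (- (p $ i)) y - y)" for v
      by norm
    ultimately have "norm (fold (\<lambda>i. G i (- (p $ i))) is (G i (- (p $ i)) y) - y) \<le> d + real (length is) * d"
      using step by (smt (verit))
    then show ?case by (simp add: algebra_simps)
  qed simp
  from this[of y "sorted_list_of_set (UNIV :: 'm set)"] y show ?thesis
    by (simp add: inv_comp_flow_def)
qed

lemma upd_has_vector_derivative:
  "((\<lambda>s. upd p j s) has_vector_derivative axis j 1) (at s within A)"
proof -
  have "upd p j = (\<lambda>s. p + (s - p $ j) *\<^sub>R axis j 1)"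
    by (auto simp: upd_def vec_eq_iff axis_def)
  then show ?thesis by (auto intro!: derivative_eq_intros)
qed

lemma upd_same: "upd p j (p $ j) = p"
  by (simp add: upd_def vec_eq_iff)

text \<open>
  The representation determines the derivative along each coordinate segment \<open>[-a\<^sub>j,a\<^sub>j]\<close>. As these
  segments are nondegenerate, this one-sided information fixes the values of the full derivative \<open>M\<close>,
  also for \<open>p\<close> on the boundary of the box.
\<close>

lemma comp_flow_parameter_derivative:
  fixes G :: "'m::{finite,linorder} \<Rightarrow> real \<Rightarrow> real^'n \<Rightarrow> real^'n"
  assumes rep: "algebraic_representation g G a S b" and a: "\<And>i. a $ i > 0"
    and p: "p \<in> cbox (- a) a" and l: "l \<in> S"
    and M: "((\<lambda>(p, x). comp_flow G p x) has_derivative M) (at (p, l))"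
  shows "M (w, 0) = (\<Sum>j\<in>UNIV. w $ j *\<^sub>R (\<Sum>i\<in>UNIV. (b j p $ i) *\<^sub>R g i (comp_flow G p l)))"
proof -
  interpret M: bounded_linear M by (rule has_derivative_bounded_linear[OF M])
  have "M (axis j 1, 0) = (\<Sum>i\<in>UNIV. (b j p $ i) *\<^sub>R g i (comp_flow G p l))" for j
  proof (rule vector_derivative_unique_within_closed_interval[where a = "- a $ j" and b = "a $ j"
        and x = "p $ j" and f = "\<lambda>s. comp_flow G (upd p j s) l"])
    show "- a $ j < a $ j" using a[of j] by simp
    show "p $ j \<in> cbox (- a $ j) (a $ j)" using p by (auto simp: mem_box_cart)
    have "((\<lambda>s. (upd p j s, l)) has_vector_derivative (axis j 1, 0)) (at (p $ j))"
      by (intro has_vector_derivative_Pair upd_has_vector_derivative has_vector_derivative_const)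
    from vector_derivative_diff_chain_within[OF this, of "\<lambda>(p, x). comp_flow G p x" M]
    have "((\<lambda>s. comp_flow G (upd p j s) l) has_vector_derivative M (axis j 1, 0)) (at (p $ j))"
      using has_derivative_at_withinI[OF M] by (simp add: upd_same o_def)
    then show "((\<lambda>s. comp_flow G (upd p j s) l) has_vector_derivative M (axis j 1, 0))
        (at (p $ j) within cbox (- a $ j) (a $ j))"
      by (rule has_vector_derivative_at_within)
    show "((\<lambda>s. comp_flow G (upd p j s) l) has_vector_derivative
        (\<Sum>i\<in>UNIV. (b j p $ i) *\<^sub>R g i (comp_flow G p l))) (at (p $ j) within cbox (- a $ j) (a $ j))"
      using rep p l unfolding algebraic_representation_def cbox_interval[of "- a $ j"] by blast
  qed
  moreover have "M (w, 0) = (\<Sum>j\<in>UNIV. w $ j *\<^sub>R M (axis j 1, 0))"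
  proof -
    have lin: "linear (\<lambda>w. M (w, 0))"
    proof (rule linearI)
      show "M (x + y, 0) = M (x, 0) + M (y, 0)" for x y using M.add[of "(x, 0)" "(y, 0)"] by simp
      show "M (r *\<^sub>R x, 0) = r *\<^sub>R M (x, 0)" for r x using M.scaleR[of r "(x, 0)"] by simp
    qed
    have "M (\<Sum>j\<in>UNIV. w $ j *\<^sub>R axis j 1, 0) = (\<Sum>j\<in>UNIV. w $ j *\<^sub>R M (axis j 1, 0))"
      by (simp add: linear_sum[OF lin] linear_cmul[OF lin])
    moreover have "(\<Sum>j\<in>UNIV. w $ j *\<^sub>R axis j 1) = w"
      using basis_expansion[of w] by (simp add: scalar_mult_eq_scaleR)
    ultimately show ?thesis by simp
  qed
  ultimately show ?thesis by simp
qed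

text \<open>
  Differentiate \<open>z(p;G(p)[\<lambda>]) = \<lambda>\<close> in \<open>p\<close>: the parameter derivative of \<open>z\<close> is minus its state derivative
  applied to the parameter derivative of \<open>G(p)[\<lambda>]\<close>.
\<close>

lemma inv_comp_flow_parameter_derivative:
  fixes G :: "'m::{finite,linorder} \<Rightarrow> real \<Rightarrow> real^'n \<Rightarrow> real^'n"
  assumes rep: "algebraic_representation g G a S b" and a: "\<And>i. a $ i > 0"
    and G_inv: "\<And>i t x. G i (- t) (G i t x) = x"
    and G_diff: "\<And>i t x. (\<lambda>(t, x). G i t x) differentiable (at (t, x))"
    and p: "p \<in> cbox (- a) a" and l: "l \<in> S" and y: "y = comp_flow G p l"
    and H: "((\<lambda>(p, y). inv_comp_flow G p y) has_derivative H) (at (p, y))"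
  shows "H (w, 0) = - (\<Sum>j\<in>UNIV. w $ j *\<^sub>R (\<Sum>i\<in>UNIV. (b j p $ i) *\<^sub>R H (0, g i y)))"
proof -
  obtain M where M: "((\<lambda>(p, x). comp_flow G p x) has_derivative M) (at (p, l))"
    using comp_flow_jointly_differentiable[of G p l] G_diff by (auto simp: differentiable_def)
  interpret M: bounded_linear M by (rule has_derivative_bounded_linear[OF M])
  interpret H: bounded_linear H by (rule has_derivative_bounded_linear[OF H])
  have "((\<lambda>p. (p, l)) has_derivative (\<lambda>w. (w, 0))) (at p)"
    by (auto intro!: derivative_eq_intros)
  from has_derivative_compose[OF this, of "\<lambda>(p, x). comp_flow G p x" M] M
  have "((\<lambda>p. comp_flow G p l) has_derivative (\<lambda>w. M (w, 0))) (at p)" by simp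
  then have "((\<lambda>p. (p, comp_flow G p l)) has_derivative (\<lambda>w. (w, M (w, 0)))) (at p)"
    by (intro has_derivative_Pair has_derivative_ident)
  from has_derivative_compose[OF this, of "\<lambda>(p, y). inv_comp_flow G p y" H] H
  have "((\<lambda>p. l) has_derivative (\<lambda>w. H (w, M (w, 0)))) (at p)"
    by (simp add: y inv_comp_flow_comp_flow G_inv)
  from has_derivative_unique[OF this has_derivative_const] have "H (w, M (w, 0)) = 0" by metis
  then have "H (w, 0) = - H (0, M (w, 0))"
    using H.add[of "(w, 0)" "(0, M (w, 0))"] by (simp add: eq_neg_iff_add_eq_0)
  moreover have lin: "linear (\<lambda>v. H (0, v))"
  proof (rule linearI)
    show "H (0, x + y) = H (0, x) + H (0, y)" for x y using H.add[of "(0, x)" "(0, y)"] by simp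
    show "H (0, r *\<^sub>R x) = r *\<^sub>R H (0, x)" for r x using H.scaleR[of r "(0, x)"] by simp
  qed
  ultimately show ?thesis
    unfolding comp_flow_parameter_derivative[OF rep a p l M] y[symmetric]
    by (simp add: linear_sum[OF lin] linear_cmul[OF lin])
qed

lemma norm_double_sum_le_entry_norm:
  fixes v :: "'m::finite \<Rightarrow> 'v::real_normed_vector"
  assumes v: "\<And>i. norm (v i) \<le> C" and w: "\<And>j. \<bar>w $ j\<bar> \<le> k" and k: "k \<ge> 0"
  shows "norm (\<Sum>j\<in>UNIV. w $ j *\<^sub>R (\<Sum>i\<in>UNIV. (b j p $ i) *\<^sub>R v i)) \<le> C * entry_norm (rep_matrix b p) * k"
proof -
  have "norm (\<Sum>j\<in>UNIV. w $ j *\<^sub>R (\<Sum>i\<in>UNIV. (b j p $ i) *\<^sub>R v i))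
      \<le> (\<Sum>j\<in>UNIV. \<bar>w $ j\<bar> * (\<Sum>i\<in>UNIV. \<bar>b j p $ i\<bar> * norm (v i)))"
    by (intro sum_norm_le) (auto intro!: mult_left_mono sum_norm_le)
  also have "\<dots> \<le> (\<Sum>j\<in>UNIV. k * (\<Sum>i\<in>UNIV. \<bar>b j p $ i\<bar> * C))"
    by (intro sum_mono mult_mono w v k sum_nonneg) auto
  also have "\<dots> = C * (\<Sum>j\<in>UNIV. \<Sum>i\<in>UNIV. \<bar>b j p $ i\<bar>) * k"
    by (simp add: sum_distrib_left sum_distrib_right mult_ac)
  also have "(\<Sum>j\<in>UNIV. \<Sum>i\<in>UNIV. \<bar>b j p $ i\<bar>) = entry_norm (rep_matrix b p)"
    unfolding entry_norm_def rep_matrix_def by (subst sum.swap) simp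
  finally show ?thesis .
qed

text \<open>
  By the chain rule the derivative of \<open>\<lambda> \<mapsto> z(v(\<lambda>);y)\<close> is a sum of the vectors \<open>\<partial>\<^sub>y z \<cdot> g\<^sub>i(y)\<close> weighted by
  \<open>b\<^sub>j\<^sup>i\<close> and the partial derivatives of \<open>v\<^sub>j\<close>, bounded by \<open>C\<^sub>1\<close>, \<open>C\<^sub>2\<close> and \<open>K\<close> respectively. Since \<open>v\<close> is
  defined on the whole space, the mean value inequality applies globally.
\<close>

lemma perturbed_inverse_contraction:
  fixes G :: "'m::{finite,linorder} \<Rightarrow> real \<Rightarrow> real^'n \<Rightarrow> real^'n" and v :: "real^'n \<Rightarrow> (real, 'm) vec"
  assumes rep: "algebraic_representation g G a S b" and a: "\<And>i. a $ i > 0"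
    and G_inv: "\<And>i t x. G i (- t) (G i t x) = x" "\<And>i t x. G i t (G i (- t) x) = x"
    and G_diff: "\<And>i t x. (\<lambda>(t, x). G i t x) differentiable (at (t, x))"
    and y: "\<And>p. p \<in> cbox (- a) a \<Longrightarrow> inv_comp_flow G p y \<in> S"
    and C1: "\<And>p i. p \<in> cbox (- a) a \<Longrightarrow> norm (jacobian (inv_comp_flow G p) (at y) *v g i y) \<le> C1"
    and C2: "\<And>p. p \<in> cbox (- a) a \<Longrightarrow> entry_norm (rep_matrix b p) \<le> C2"
    and v: "\<And>l. v l \<in> cbox (- a) a" "\<And>l. v differentiable (at l)"
    and K: "\<And>l i. \<exists>D. GDERIV (\<lambda>l. v l $ i) l :> D \<and> norm D \<le> K" and K0: "K \<ge> 0"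
  shows "norm (inv_comp_flow G (v l) y - inv_comp_flow G (v l') y) \<le> C1 * C2 * K * norm (l - l')"
proof -
  have "\<exists>F'. ((\<lambda>l. inv_comp_flow G (v l) y) has_derivative F') (at l) \<and> onorm F' \<le> C1 * C2 * K" for l
  proof -
    let ?p = "v l"
    obtain H where H: "((\<lambda>(p, y). inv_comp_flow G p y) has_derivative H) (at (?p, y))"
      using inv_comp_flow_jointly_differentiable[of G ?p y] G_diff by (auto simp: differentiable_def)
    obtain v' where v': "(v has_derivative v') (at l)" using v(2) by (auto simp: differentiable_def)
    have "((\<lambda>l. (v l, y)) has_derivative (\<lambda>h. (v' h, 0))) (at l)"
      by (intro has_derivative_Pair v' has_derivative_const)
    from has_derivative_compose[OF this, of "\<lambda>(p, y). inv_comp_flow G p y" H] H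
    have F': "((\<lambda>l. inv_comp_flow G (v l) y) has_derivative (\<lambda>h. H (v' h, 0))) (at l)" by simp
    have "((\<lambda>y. (?p, y)) has_derivative (\<lambda>h. (0, h))) (at y)"
      by (auto intro!: derivative_eq_intros)
    from has_derivative_compose[OF this, of "\<lambda>(p, y). inv_comp_flow G p y" H] H
    have "(inv_comp_flow G ?p has_derivative (\<lambda>h. H (0, h))) (at y)" by simp
    from jacobian_mult_eq[OF this] have H_g: "norm (H (0, g i y)) \<le> C1" for i
      using C1[OF v(1)] by metis
    have C1_nonneg: "C1 \<ge> 0" using order_trans[OF norm_ge_zero H_g] by blast
    have bound: "norm (H (v' h, 0)) \<le> C1 * C2 * K * norm h" for h
    proof -
      have comp: "\<bar>v' h $ j\<bar> \<le> K * norm h" for j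
      proof -
        obtain D where D: "GDERIV (\<lambda>l. v l $ j) l :> D" "norm D \<le> K" using K by blast
        have "((\<lambda>l. v l $ j) has_derivative (\<lambda>h. v' h $ j)) (at l)"
          by (rule bounded_linear.has_derivative[OF bounded_linear_vec_nth v'])
        from has_derivative_unique[OF this D(1)[unfolded gderiv_def]]
        have "v' h $ j = h \<bullet> D" by metis
        also have "\<bar>h \<bullet> D\<bar> \<le> norm h * norm D" by (rule Cauchy_Schwarz_ineq2)
        also have "\<dots> \<le> K * norm h" using mult_right_mono[OF D(2) norm_ge_zero[of h]] by (simp add: mult.commute)
        finally show ?thesis .
      qed
      have "y = comp_flow G ?p (inv_comp_flow G ?p y)"
        by (simp add: comp_flow_inv_comp_flow G_inv(2))
      then have H_eq: "H (v' h, 0) =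
          - (\<Sum>j\<in>UNIV. v' h $ j *\<^sub>R (\<Sum>i\<in>UNIV. (b j ?p $ i) *\<^sub>R H (0, g i y)))"
        by (intro inv_comp_flow_parameter_derivative[OF rep a _ _ v(1) y[OF v(1)] _ H] G_inv(1) G_diff)
      have "norm (H (v' h, 0)) \<le> C1 * entry_norm (rep_matrix b ?p) * (K * norm h)"
        unfolding H_eq norm_minus_cancel
        by (rule norm_double_sum_le_entry_norm[OF H_g comp]) (use K0 in simp)
      also have "\<dots> \<le> C1 * C2 * (K * norm h)"
        using C1_nonneg K0 by (intro mult_right_mono mult_left_mono C2 v(1)) auto
      finally show ?thesis by (simp add: mult.assoc)
    qed
    have "onorm (\<lambda>h. H (v' h, 0)) \<le> C1 * C2 * K"
      by (rule onorm_le) (rule bound)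
    with F' show ?thesis by blast
  qed
  then obtain F' where F': "\<And>l. ((\<lambda>l. inv_comp_flow G (v l) y) has_derivative F' l) (at l)"
    "\<And>l. onorm (F' l) \<le> C1 * C2 * K" by metis
  show ?thesis
    by (rule differentiable_bound[of UNIV _ F']) (auto intro: F')
qed

section \<open>Stieltjes integrals against functions of bounded variation\<close>

text \<open>
  Both sides are the integral against one and the same measure, \<open>M + N = M' + N'\<close>. Equality is
  extended from indicator functions to nonnegative measurable functions by monotone classes, and to
  integrable functions by splitting into positive and negative part.
\<close>

lemma integral_add_eq_if_measure_add_eq:
  fixes f :: "'a \<Rightarrow> real"
  assumes fin: "finite_measure M" "finite_measure N" "finite_measure M'" "finite_measure N'"
    and sets: "sets N = sets M" "sets M' = sets M" "sets N' = sets M"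
    and eq: "\<And>A. A \<in> sets M \<Longrightarrow> measure M A + measure N A = measure M' A + measure N' A"
    and f: "integrable M f" "integrable N f" "integrable M' f" "integrable N' f"
  shows "integral\<^sup>L M f + integral\<^sup>L N f = integral\<^sup>L M' f + integral\<^sup>L N' f"
proof -
  note cong = measurable_cong_sets[OF sets(1) refl] measurable_cong_sets[OF sets(2) refl]
    measurable_cong_sets[OF sets(3) refl]
  have nn: "(\<integral>\<^sup>+x. h x \<partial>M) + (\<integral>\<^sup>+x. h x \<partial>N) = (\<integral>\<^sup>+x. h x \<partial>M') + (\<integral>\<^sup>+x. h x \<partial>N')"
    if "h \<in> borel_measurable M" for h
    using that
  proof (induction h rule: borel_measurable_induct)
    case (cong f g)
    have "space N = space M" "space M' = space M" "space N' = space M"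
      using sets by (auto dest: sets_eq_imp_space_eq)
    then show ?case using cong nn_integral_cong[of M f g] nn_integral_cong[of N f g]
        nn_integral_cong[of M' f g] nn_integral_cong[of N' f g] by simp
  next
    case (set A)
    have "ennreal (measure M A) + ennreal (measure N A) = ennreal (measure M' A) + ennreal (measure N' A)"
      using eq[OF set] by (simp add: ennreal_plus[symmetric] del: ennreal_plus)
    with set show ?case
      using fin by (simp add: sets finite_measure.emeasure_eq_measure)
  next
    case (mult u c)
    then show ?case
      by (simp add: nn_integral_cmult cong distrib_left[symmetric])
  next
    case (add u v)
    then show ?case
      by (simp add: nn_integral_add cong) (metis (no_types, lifting) add.assoc add.commute)
  next
    case (seq U)
    have *: "(\<integral>\<^sup>+x. (SUP i. U i) x \<partial>K) = (SUP i. \<integral>\<^sup>+x. U i x \<partial>K)" if "sets K = sets M" for K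
      using seq.hyps(1,3) nn_integral_monotone_convergence_SUP[of U K]
      by (simp add: measurable_cong_sets[OF that refl] image_comp)
    have mono: "incseq (\<lambda>i. \<integral>\<^sup>+x. U i x \<partial>K)" for K
      using seq.hyps(3) by (auto simp: incseq_def le_fun_def intro!: nn_integral_mono)
    show ?case
      by (simp only: * sets refl ennreal_SUP_add[OF mono mono, symmetric] seq.IH)
  qed
  have fm: "f \<in> borel_measurable M" using f(1) by auto
  have "integral\<^sup>L M f + integral\<^sup>L N f =
      enn2real ((\<integral>\<^sup>+x. f x \<partial>M) + (\<integral>\<^sup>+x. f x \<partial>N)) - enn2real ((\<integral>\<^sup>+x. - f x \<partial>M) + (\<integral>\<^sup>+x. - f x \<partial>N))"
    using f(1,2) by (simp add: real_lebesgue_integral_def real_integrable_def enn2real_plus less_top)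
  also have "\<dots> = enn2real ((\<integral>\<^sup>+x. f x \<partial>M') + (\<integral>\<^sup>+x. f x \<partial>N')) - enn2real ((\<integral>\<^sup>+x. - f x \<partial>M') + (\<integral>\<^sup>+x. - f x \<partial>N'))"
    using nn[of "\<lambda>x. ennreal (f x)"] nn[of "\<lambda>x. ennreal (- f x)"] fm by simp
  also have "\<dots> = integral\<^sup>L M' f + integral\<^sup>L N' f"
    using f(3,4) by (simp add: real_lebesgue_integral_def real_integrable_def enn2real_plus less_top)
  finally show ?thesis .
qed

text \<open>
  If \<open>P - Q = P' - Q'\<close> on \<open>[c,d]\<close>, then \<open>P + Q'\<close> and \<open>P' + Q\<close> have the same increments there, so the
  corresponding sums of measures agree on half-open intervals and hence on all Borel subsets of \<open>(c,d]\<close>.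
\<close>

lemma has_stieltjes_integral_unique:
  assumes I: "has_stieltjes_integral f h c d I" and J: "has_stieltjes_integral f h c d J"
  shows "I = J"
proof -
  obtain P Q where PQ: "mono P" "mono Q" "\<And>s. continuous (at_right s) P" "\<And>s. continuous (at_right s) Q"
    "\<And>s. s \<in> {c..d} \<Longrightarrow> h s = P s - Q s"
    "set_integrable (interval_measure P) {c<..d} f" "set_integrable (interval_measure Q) {c<..d} f"
    and I_eq: "I = (LINT s:{c<..d}|interval_measure P. f s) - (LINT s:{c<..d}|interval_measure Q. f s)"
    using I unfolding has_stieltjes_integral_def by blast
  obtain P' Q' where PQ': "mono P'" "mono Q'" "\<And>s. continuous (at_right s) P'" "\<And>s. continuous (at_right s) Q'"
    "\<And>s. s \<in> {c..d} \<Longrightarrow> h s = P' s - Q' s"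
    "set_integrable (interval_measure P') {c<..d} f" "set_integrable (interval_measure Q') {c<..d} f"
    and J_eq: "J = (LINT s:{c<..d}|interval_measure P'. f s) - (LINT s:{c<..d}|interval_measure Q'. f s)"
    using J unfolding has_stieltjes_integral_def by blast
  \<comment> \<open>Restricting to \<open>(c,d]\<close> makes the measures finite and forgets the behaviour of the
    integrators elsewhere.\<close>
  define \<mu> where "\<mu> F = density (interval_measure F) (indicator {c<..d})" for F
  define f' where "f' s = indicat_real {c<..d} s * f s" for s
  have sets: "sets (\<mu> F) = sets borel" for F by (simp add: \<mu>_def)
  have space: "space (\<mu> F) = UNIV" for F by (simp add: \<mu>_def)
  have em: "emeasure (\<mu> F) A = emeasure (interval_measure F) (A \<inter> {c<..d})" if "A \<in> sets borel" for F A
    using that unfolding \<mu>_def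
    by (subst emeasure_density) (auto simp: indicator_inter_arith[symmetric] Int_commute)
  have meas_Ioc: "measure (\<mu> F) {a<..b} = (if max c a \<le> min d b then F (min d b) - F (max c a) else 0)"
    and fin: "finite_measure (\<mu> F)"
    if F: "mono F" "\<And>s. continuous (at_right s) F" for F a b
  proof -
    have *: "emeasure (\<mu> F) {a<..b} = ennreal (if max c a \<le> min d b then F (min d b) - F (max c a) else 0)" for a b
    proof -
      have "{a<..b} \<inter> {c<..d} = {max c a<..min d b}" by auto
      then show ?thesis
        using em[of "{a<..b}" F] by (simp add: emeasure_interval_measure_Ioc_eq[OF monoD[OF F(1)] F(2)])
    qed
    show "measure (\<mu> F) {a<..b} = (if max c a \<le> min d b then F (min d b) - F (max c a) else 0)"
      using F(1) unfolding measure_def * by (subst enn2real_ennreal) (auto simp: mono_def)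
    show "finite_measure (\<mu> F)"
      using F by (intro finite_measureI) (simp add: em space emeasure_interval_measure_Ioc_eq monoD)
  qed
  interpret P: finite_measure "\<mu> P" using PQ by (intro fin)
  interpret Q: finite_measure "\<mu> Q" using PQ by (intro fin)
  interpret P': finite_measure "\<mu> P'" using PQ' by (intro fin)
  interpret Q': finite_measure "\<mu> Q'" using PQ' by (intro fin)
  have whole: "measure (\<mu> F) UNIV = (if c \<le> d then F d - F c else 0)"
    if F: "mono F" "\<And>s. continuous (at_right s) F" for F
    using F(1) unfolding measure_def
    by (simp add: em emeasure_interval_measure_Ioc_eq[OF monoD[OF F(1)] F(2)] mono_def)
  have PQ_eq: "P s - Q s = P' s - Q' s" if "s \<in> {c..d}" for s using PQ(5) PQ'(5) that by metis
  have eq: "measure (\<mu> P) A + measure (\<mu> Q') A = measure (\<mu> P') A + measure (\<mu> Q) A"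
    if "A \<in> sets borel" for A
  proof -
    have A: "A \<in> sigma_sets UNIV (range (\<lambda>(a, b). {a<..b::real}))"
      using that unfolding borel_sigma_sets_Ioc by simp
    have stable: "Int_stable (range (\<lambda>(a, b). {a<..b::real}))"
    proof (intro Int_stableI)
      fix A B assume "A \<in> range (\<lambda>(a, b). {a<..b::real})" "B \<in> range (\<lambda>(a, b). {a<..b::real})"
      then obtain a b c d where "A = {a<..b}" "B = {c<..d}" by auto
      then have "A \<inter> B = (\<lambda>(a, b). {a<..b}) (max a c, min b d)" by auto
      then show "A \<inter> B \<in> range (\<lambda>(a, b). {a<..b::real})" by (rule range_eqI)
    qed
    have "range (\<lambda>(a, b). {a<..b::real}) \<subseteq> Pow UNIV" by simp
    from stable this A show ?thesis
    proof (induction A rule: sigma_sets_induct_disjoint)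
      case (basic A)
      then obtain a b where A: "A = {a<..b}" by auto
      show ?case
      proof (cases "max c a \<le> min d b")
        case True
        then have "min d b \<in> {c..d}" "max c a \<in> {c..d}" by auto
        from PQ_eq[OF this(1)] PQ_eq[OF this(2)] show ?thesis
          unfolding A meas_Ioc[OF PQ(1,3)] meas_Ioc[OF PQ(2,4)] meas_Ioc[OF PQ'(1,3)] meas_Ioc[OF PQ'(2,4)]
          using True by argo
      next
        case False
        show ?thesis
          unfolding A meas_Ioc[OF PQ(1,3)] meas_Ioc[OF PQ(2,4)] meas_Ioc[OF PQ'(1,3)] meas_Ioc[OF PQ'(2,4)]
            if_not_P[OF False] by simp
      qed
    next
      case empty then show ?case by simp
    next
      case (compl A)
      then have "A \<in> sets borel" unfolding borel_sigma_sets_Ioc by simp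
      moreover have "measure (\<mu> P) UNIV + measure (\<mu> Q') UNIV = measure (\<mu> P') UNIV + measure (\<mu> Q) UNIV"
        unfolding whole[OF PQ(1,3)] whole[OF PQ(2,4)] whole[OF PQ'(1,3)] whole[OF PQ'(2,4)]
        using PQ_eq[of c] PQ_eq[of d] by (cases "c \<le> d") auto
      ultimately show ?case
        using compl P.finite_measure_compl[of A] Q.finite_measure_compl[of A]
          P'.finite_measure_compl[of A] Q'.finite_measure_compl[of A] by (simp add: sets space)
    next
      case (union A)
      then have A: "range A \<subseteq> sets borel" using union.hyps(2) unfolding borel_sigma_sets_Ioc by simp
      note UN = P.finite_measure_UNION Q.finite_measure_UNION P'.finite_measure_UNION Q'.finite_measure_UNION
      have "(\<lambda>i. measure (\<mu> P) (A i) + measure (\<mu> Q') (A i)) sums (measure (\<mu> P) (\<Union>i. A i) + measure (\<mu> Q') (\<Union>i. A i))"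
        using A union.hyps(1) by (intro sums_add UN) (auto simp: sets)
      moreover have "(\<lambda>i. measure (\<mu> P') (A i) + measure (\<mu> Q) (A i)) sums (measure (\<mu> P') (\<Union>i. A i) + measure (\<mu> Q) (\<Union>i. A i))"
        using A union.hyps(1) by (intro sums_add UN) (auto simp: sets)
      ultimately show ?case unfolding union.IH by (rule sums_unique2)
    qed
  qed
  have int: "integrable (\<mu> F) f'" and lint: "integral\<^sup>L (\<mu> F) f' = (LINT s:{c<..d}|interval_measure F. f s)"
    if "set_integrable (interval_measure F) {c<..d} f" for F
  proof -
    have 1: "integrable (interval_measure F) f'"
      using that by (simp add: set_integrable_def f'_def[abs_def])
    have 2: "(\<lambda>s. indicat_real {c<..d} s * f' s) = f'"
      by (auto simp: f'_def indicator_def)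
    have 3: "\<mu> F = density (interval_measure F) (\<lambda>s. ennreal (indicat_real {c<..d} s))"
      unfolding \<mu>_def by (simp add: ennreal_indicator)
    show "integrable (\<mu> F) f'"
      unfolding 3 using 1 by (subst integrable_density) (auto simp: 2)
    show "integral\<^sup>L (\<mu> F) f' = (LINT s:{c<..d}|interval_measure F. f s)"
      unfolding 3 using 1
      by (subst integral_density) (auto simp: 2, simp add: f'_def[abs_def] set_lebesgue_integral_def)
  qed
  have "integral\<^sup>L (\<mu> P) f' + integral\<^sup>L (\<mu> Q') f' = integral\<^sup>L (\<mu> P') f' + integral\<^sup>L (\<mu> Q) f'"
    by (rule integral_add_eq_if_measure_add_eq)
      (use eq in \<open>auto simp: sets int PQ PQ' P.finite_measure_axioms Q.finite_measure_axioms
        P'.finite_measure_axioms Q'.finite_measure_axioms\<close>)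
  then show ?thesis unfolding I_eq J_eq by (simp add: lint PQ PQ')
qed

text \<open>
  The partitions of \<open>[c,x]\<close> are encoded as in \<open>bounded_variation_on\<close>: a monotone sequence is read up to
  index \<open>n\<close>, so repeated points are allowed.
\<close>

definition variation :: "(real \<Rightarrow> real) \<Rightarrow> real \<Rightarrow> real \<Rightarrow> real" where
  "variation h c x = (SUP (n, \<sigma>) \<in> {(n :: nat, \<sigma>). mono \<sigma> \<and> \<sigma> 0 = c \<and> \<sigma> n = x}.
     \<Sum>k<n. \<bar>h (\<sigma> (Suc k)) - h (\<sigma> k)\<bar>)"

text \<open>
  Appending one point to a partition compares variations over different intervals.
\<close>

lemma variation_sum_extend:
  fixes h :: "real \<Rightarrow> real" and \<sigma> :: "nat \<Rightarrow> real"
  assumes \<sigma>: "mono \<sigma>" "\<sigma> n = x" and xy: "x \<le> y"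
  obtains \<sigma>' where "mono \<sigma>'" "\<sigma>' 0 = \<sigma> 0" "\<sigma>' (Suc n) = y"
    "(\<Sum>k<Suc n. \<bar>h (\<sigma>' (Suc k)) - h (\<sigma>' k)\<bar>) = (\<Sum>k<n. \<bar>h (\<sigma> (Suc k)) - h (\<sigma> k)\<bar>) + \<bar>h y - h x\<bar>"
proof (rule that[of "\<lambda>k. if k \<le> n then \<sigma> k else y"])
  have "\<sigma> k \<le> y" if "k \<le> n" for k using monoD[OF \<sigma>(1) that] \<sigma>(2) xy by simp
  then show "mono (\<lambda>k. if k \<le> n then \<sigma> k else y)" using \<sigma>(1) by (auto simp: mono_def)
qed (use \<sigma>(2) in auto)

context
  fixes h :: "real \<Rightarrow> real" and c d :: real
  assumes bv: "bounded_variation_on c d h"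
begin

lemma variation_bdd_above:
  assumes "x \<le> d"
  shows "bdd_above ((\<lambda>(n, \<sigma>). \<Sum>k<n. \<bar>h (\<sigma> (Suc k)) - h (\<sigma> k)\<bar>)
    ` {(n :: nat, \<sigma>). mono \<sigma> \<and> \<sigma> 0 = c \<and> \<sigma> n = x})"
proof -
  obtain B where B: "\<And>(n::nat) s. mono s \<Longrightarrow> s 0 = c \<Longrightarrow> s n = d \<Longrightarrow> (\<Sum>k<n. \<bar>h (s (Suc k)) - h (s k)\<bar>) \<le> B"
    using bv unfolding bounded_variation_on_def by blast
  have "(\<Sum>k<n. \<bar>h (\<sigma> (Suc k)) - h (\<sigma> k)\<bar>) \<le> B" if \<sigma>: "mono \<sigma>" "\<sigma> 0 = c" "\<sigma> n = x" for n \<sigma>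
  proof (rule variation_sum_extend[OF \<sigma>(1,3) assms, of h])
    fix \<sigma>' assume \<sigma>': "mono \<sigma>'" "\<sigma>' 0 = \<sigma> 0" "\<sigma>' (Suc n) = d"
      "(\<Sum>k<Suc n. \<bar>h (\<sigma>' (Suc k)) - h (\<sigma>' k)\<bar>) = (\<Sum>k<n. \<bar>h (\<sigma> (Suc k)) - h (\<sigma> k)\<bar>) + \<bar>h d - h x\<bar>"
    have "(\<Sum>k<Suc n. \<bar>h (\<sigma>' (Suc k)) - h (\<sigma>' k)\<bar>) \<le> B"
      using \<sigma>'(2) \<sigma>(2) by (intro B \<sigma>'(1,3)) simp
    then show ?thesis unfolding \<sigma>'(4) by linarith
  qed
  then show ?thesis by (intro bdd_aboveI[of _ B]) auto
qed

lemma variation_upper: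
  assumes "mono \<sigma>" "\<sigma> 0 = c" "\<sigma> n = x" "x \<le> d"
  shows "(\<Sum>k<n. \<bar>h (\<sigma> (Suc k)) - h (\<sigma> k)\<bar>) \<le> variation h c x"
  unfolding variation_def
  by (rule cSUP_upper2[OF variation_bdd_above[OF assms(4)], of "(n, \<sigma>)"]) (use assms in auto)

lemma variation_least:
  assumes "c \<le> x"
    and "\<And>n \<sigma>. mono \<sigma> \<Longrightarrow> \<sigma> 0 = c \<Longrightarrow> \<sigma> n = x \<Longrightarrow> (\<Sum>k<n. \<bar>h (\<sigma> (Suc k)) - h (\<sigma> k)\<bar>) \<le> B"
  shows "variation h c x \<le> B"
  unfolding variation_def
proof (rule cSUP_least)
  have "(Suc 0, \<lambda>k. if k = 0 then c else x) \<in> {(n :: nat, \<sigma>). mono \<sigma> \<and> \<sigma> 0 = c \<and> \<sigma> n = x}"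
    using assms(1) by (auto simp: mono_def)
  then show "{(n :: nat, \<sigma>). mono \<sigma> \<and> \<sigma> 0 = c \<and> \<sigma> n = x} \<noteq> {}" by blast
qed (use assms(2) in auto)

lemma variation_increase:
  assumes "c \<le> x" "x \<le> y" "y \<le> d"
  shows "\<bar>h y - h x\<bar> \<le> variation h c y - variation h c x"
proof -
  have "variation h c x \<le> variation h c y - \<bar>h y - h x\<bar>"
  proof (rule variation_least[OF assms(1)])
    fix n and \<sigma> :: "nat \<Rightarrow> real" assume \<sigma>: "mono \<sigma>" "\<sigma> 0 = c" "\<sigma> n = x"
    show "(\<Sum>k<n. \<bar>h (\<sigma> (Suc k)) - h (\<sigma> k)\<bar>) \<le> variation h c y - \<bar>h y - h x\<bar>"
    proof (rule variation_sum_extend[OF \<sigma>(1,3) assms(2), of h])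
      fix \<sigma>' assume \<sigma>': "mono \<sigma>'" "\<sigma>' 0 = \<sigma> 0" "\<sigma>' (Suc n) = y"
        "(\<Sum>k<Suc n. \<bar>h (\<sigma>' (Suc k)) - h (\<sigma>' k)\<bar>) = (\<Sum>k<n. \<bar>h (\<sigma> (Suc k)) - h (\<sigma> k)\<bar>) + \<bar>h y - h x\<bar>"
      have "(\<Sum>k<Suc n. \<bar>h (\<sigma>' (Suc k)) - h (\<sigma>' k)\<bar>) \<le> variation h c y"
        using \<sigma>'(2) \<sigma>(2) by (intro variation_upper \<sigma>'(1,3) assms(3)) simp
      then show ?thesis unfolding \<sigma>'(4) by linarith
    qed
  qed
  then show ?thesis by simp
qed

text \<open>
  A partition of \<open>[c,y]\<close> is cut at \<open>x\<close>: the parts \<open>min \<sigma> x\<close> contribute at most the variation up to \<open>x\<close>,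
  and the parts \<open>max \<sigma> x\<close> contribute at most \<open>L\<close> times a telescoping sum.
\<close>

lemma variation_lipschitz:
  assumes "c \<le> x" "x \<le> y" "y \<le> d"
    and lip: "\<And>r s. r \<in> {x..y} \<Longrightarrow> s \<in> {x..y} \<Longrightarrow> \<bar>h s - h r\<bar> \<le> L * \<bar>s - r\<bar>"
  shows "variation h c y - variation h c x \<le> L * (y - x)"
proof -
  have "variation h c y \<le> variation h c x + L * (y - x)"
  proof (rule variation_least)
    show "c \<le> y" using assms by simp
    fix n and \<sigma> :: "nat \<Rightarrow> real" assume \<sigma>: "mono \<sigma>" "\<sigma> 0 = c" "\<sigma> n = y"
    have "(\<Sum>k<n. \<bar>h (\<sigma> (Suc k)) - h (\<sigma> k)\<bar>) \<le>
        (\<Sum>k<n. \<bar>h (min (\<sigma> (Suc k)) x) - h (min (\<sigma> k) x)\<bar> + L * (max (\<sigma> (Suc k)) x - max (\<sigma> k) x))"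
    proof (rule sum_mono)
      fix k assume "k \<in> {..<n}"
      then have k: "\<sigma> k \<le> \<sigma> (Suc k)" "\<sigma> (Suc k) \<le> y"
        using monoD[OF \<sigma>(1), of k "Suc k"] monoD[OF \<sigma>(1), of "Suc k" n] \<sigma>(3) by auto
      have "\<bar>h (max (\<sigma> (Suc k)) x) - h (max (\<sigma> k) x)\<bar> \<le> L * \<bar>max (\<sigma> (Suc k)) x - max (\<sigma> k) x\<bar>"
        using k assms(2) by (intro lip) auto
      also have "\<bar>max (\<sigma> (Suc k)) x - max (\<sigma> k) x\<bar> = max (\<sigma> (Suc k)) x - max (\<sigma> k) x"
        using k by auto
      finally show "\<bar>h (\<sigma> (Suc k)) - h (\<sigma> k)\<bar> \<le>
          \<bar>h (min (\<sigma> (Suc k)) x) - h (min (\<sigma> k) x)\<bar> + L * (max (\<sigma> (Suc k)) x - max (\<sigma> k) x)"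
        using k(1) by (auto simp: min_def max_def split: if_splits)
    qed
    also have "\<dots> = (\<Sum>k<n. \<bar>h (min (\<sigma> (Suc k)) x) - h (min (\<sigma> k) x)\<bar>) + L * (max (\<sigma> n) x - max (\<sigma> 0) x)"
      by (simp add: sum.distrib sum_distrib_left[symmetric] sum_lessThan_telescope[of "\<lambda>k. max (\<sigma> k) x"])
    also have "max (\<sigma> n) x - max (\<sigma> 0) x = y - x" using \<sigma> assms by simp
    also have "(\<Sum>k<n. \<bar>h (min (\<sigma> (Suc k)) x) - h (min (\<sigma> k) x)\<bar>) \<le> variation h c x"
    proof (rule variation_upper)
      show "mono (\<lambda>k. min (\<sigma> k) x)" using \<sigma>(1) by (auto simp: mono_def min_le_iff_disj)
    qed (use \<sigma> assms in auto)
    finally show "(\<Sum>k<n. \<bar>h (\<sigma> (Suc k)) - h (\<sigma> k)\<bar>) \<le> variation h c x + L * (y - x)" by simp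
  qed
  then show ?thesis by simp
qed

text \<open>
  \<open>P\<close> is the total variation and \<open>Q = P - h\<close>, both extended to be constant outside \<open>[c,t]\<close>. Where \<open>h\<close> is
  Lipschitz they inherit its Lipschitz bound up to a factor two; applied on short intervals to the
  right of each point this gives right-continuity.
\<close>

lemma jordan_decomposition:
  assumes t: "t \<in> {c..d}"
    and right_lip: "\<And>s. s \<in> {c..<t} \<Longrightarrow> \<exists>e>0. \<exists>L. \<forall>x\<in>{s..s+e}. \<forall>y\<in>{s..s+e}. \<bar>h y - h x\<bar> \<le> L * \<bar>y - x\<bar>"
  obtains P Q where "mono P" "mono Q" "\<And>s. continuous (at_right s) P" "\<And>s. continuous (at_right s) Q"
    "\<And>s. s \<in> {c..t} \<Longrightarrow> h s = P s - Q s"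
    "\<And>x y L. c \<le> x \<Longrightarrow> x \<le> y \<Longrightarrow> y \<le> t \<Longrightarrow>
       (\<And>r s. r \<in> {x..y} \<Longrightarrow> s \<in> {x..y} \<Longrightarrow> \<bar>h s - h r\<bar> \<le> L * \<bar>s - r\<bar>) \<Longrightarrow>
       P y - P x \<le> L * (y - x) \<and> Q y - Q x \<le> 2 * L * (y - x)"
proof -
  define \<pi> where "\<pi> s = max c (min t s)" for s
  have \<pi>: "c \<le> \<pi> s" "\<pi> s \<le> t" "\<pi> s \<le> d" for s using t by (auto simp: \<pi>_def)
  have \<pi>_mono: "\<pi> r \<le> \<pi> s" if "r \<le> s" for r s using that by (auto simp: \<pi>_def)
  have \<pi>_id: "\<pi> s = s" if "s \<in> {c..t}" for s using that by (auto simp: \<pi>_def)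
  define P where "P s = variation h c (\<pi> s)" for s
  define Q where "Q s = P s - h (\<pi> s)" for s
  have inc: "\<bar>h (\<pi> y) - h (\<pi> x)\<bar> \<le> P y - P x" if "x \<le> y" for x y
    unfolding P_def using that by (intro variation_increase \<pi> \<pi>_mono)
  have mono: "mono P" "mono Q"
    using inc by (force simp: mono_def Q_def)+
  have bound: "P y - P x \<le> L * (y - x) \<and> Q y - Q x \<le> 2 * L * (y - x)"
    if xy: "c \<le> x" "x \<le> y" "y \<le> t"
      and lip: "\<And>r s. r \<in> {x..y} \<Longrightarrow> s \<in> {x..y} \<Longrightarrow> \<bar>h s - h r\<bar> \<le> L * \<bar>s - r\<bar>" for x y L
  proof -
    have "P y - P x \<le> L * (y - x)"
      proof -
      have "variation h c y - variation h c x \<le> L * (y - x)"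
        using xy t by (intro variation_lipschitz lip) auto
      then show ?thesis using xy by (simp add: P_def \<pi>_id)
    qed
    moreover have "\<bar>h y - h x\<bar> \<le> L * (y - x)" using lip[of x y] xy by simp
    ultimately show ?thesis using xy by (simp add: Q_def \<pi>_id algebra_simps)
  qed
  have cont: "continuous (at_right s) P" "continuous (at_right s) Q" for s
  proof -
    have "\<exists>e>0. \<exists>L. \<forall>y\<in>{s<..<s+e}. P y - P s \<le> L * (y - s) \<and> Q y - Q s \<le> 2 * L * (y - s)"
    proof (cases "s \<in> {c..<t}")
      case True
      then obtain e L where e: "e > 0"
        "\<forall>x\<in>{s..s+e}. \<forall>y\<in>{s..s+e}. \<bar>h y - h x\<bar> \<le> L * \<bar>y - x\<bar>" using right_lip by blast
      have "P y - P s \<le> L * (y - s) \<and> Q y - Q s \<le> 2 * L * (y - s)" if "y \<in> {s<..<s + min e (t - s)}" for y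
        using that True e(2) by (intro bound) auto
      moreover have "min e (t - s) > 0" using e(1) True by simp
      ultimately show ?thesis by blast
    next
      case False
      define e where "e = (if s < c then c - s else 1)"
      have "\<pi> y = \<pi> s" if "y \<in> {s<..<s+e}" for y
        using that False t by (auto simp: \<pi>_def e_def split: if_splits)
      then have "P y - P s \<le> 0 * (y - s) \<and> Q y - Q s \<le> 2 * 0 * (y - s)" if "y \<in> {s<..<s+e}" for y
        using that by (simp add: P_def Q_def)
      moreover have "e > 0" by (simp add: e_def)
      ultimately show ?thesis by blast
    qed
    then obtain e L where e: "e > 0"
      and le: "\<And>y. y \<in> {s<..<s+e} \<Longrightarrow> P y - P s \<le> L * (y - s)"
        "\<And>y. y \<in> {s<..<s+e} \<Longrightarrow> Q y - Q s \<le> 2 * L * (y - s)" by blast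
    have squeeze: "continuous (at_right s) F"
      if F: "mono F" and le: "\<And>y. y \<in> {s<..<s+e} \<Longrightarrow> F y - F s \<le> M * (y - s)" for F M
    proof -
      have "\<forall>\<^sub>F y in at_right s. y \<in> {s<..<s+e}"
        using e by (intro eventually_at_right_field[THEN iffD2] exI[of _ "s + e"]) auto
      then have "\<forall>\<^sub>F y in at_right s. norm (F y - F s) \<le> M * (y - s)"
        by eventually_elim (use le F in \<open>auto simp: mono_def\<close>)
      moreover have "((\<lambda>y. M * (y - s)) \<longlongrightarrow> M * (s - s)) (at_right s)" by (intro tendsto_intros)
      then have "((\<lambda>y. M * (y - s)) \<longlongrightarrow> 0) (at_right s)" by simp
      ultimately have "((\<lambda>y. F y - F s) \<longlongrightarrow> 0) (at_right s)"
        by (rule Lim_null_comparison)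
      then show ?thesis by (simp add: continuous_within Lim_null[symmetric])
    qed
    show "continuous (at_right s) P" "continuous (at_right s) Q"
      using squeeze[OF mono(1) le(1)] squeeze[OF mono(2) le(2)] by auto
  qed
  show ?thesis
    by (rule that[OF mono cont _ bound]) (auto simp: Q_def \<pi>_id)
qed

end

lemma interval_measure_integral_deviation:
  fixes f F :: "real \<Rightarrow> real"
  assumes F: "mono F" "\<And>s. continuous (at_right s) F" and xy: "x \<le> y"
    and int: "set_integrable (interval_measure F) {x<..y} f"
    and near: "\<And>r. r \<in> {x<..y} \<Longrightarrow> \<bar>f r - k\<bar> \<le> \<epsilon>"
  shows "\<bar>(LINT r:{x<..y}|interval_measure F. f r) - k * (F y - F x)\<bar> \<le> \<epsilon> * (F y - F x)"
proof -
  note meas = measure_interval_measure_Ioc[OF xy monoD[OF F(1)] F(2)]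
    emeasure_interval_measure_Ioc[OF xy monoD[OF F(1)] F(2)]
  have const_int: "set_integrable (interval_measure F) {x<..y} (\<lambda>_. k)" for k :: real
    unfolding set_integrable_def by (simp add: meas)
  have const: "(LINT r:{x<..y}|interval_measure F. k) = k * (F y - F x)" for k :: real
    unfolding set_lebesgue_integral_def by (simp add: meas)
  have "\<bar>(LINT r:{x<..y}|interval_measure F. f r) - k * (F y - F x)\<bar> =
      norm (LINT r:{x<..y}|interval_measure F. f r - k)"
    unfolding const[symmetric] using int const_int by (subst set_integral_diff) auto
  also have "\<dots> \<le> (LINT r:{x<..y}|interval_measure F. norm (f r - k))"
    by (intro set_integral_norm_bound set_integral_diff int const_int)
  also have "\<dots> \<le> (LINT r:{x<..y}|interval_measure F. \<epsilon>)"
    using near by (intro set_integral_mono const_int set_integrable_abs[unfolded real_norm_def[symmetric]]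
        set_integral_diff int) auto
  finally show ?thesis by (simp add: const)
qed

text \<open>
  On a short interval from \<open>x\<close> to \<open>y\<close> near \<open>t\<close> the integrals against \<open>P\<close> and \<open>Q\<close> differ from
  \<open>f(t)(P(y) - P(x))\<close> and \<open>f(t)(Q(y) - Q(x))\<close> by the oscillation of \<open>f\<close> times the increments, which are
  \<open>O(y - x)\<close>. So the integral minus \<open>f(t) h\<close> has derivative zero at \<open>t\<close>.
\<close>

lemma stieltjes_integral_has_derivative:
  fixes f h :: "real \<Rightarrow> real"
  assumes bv: "bounded_variation_on c d h" and pq: "c \<le> p" "q \<le> d"
    and right_lip: "\<And>s. s \<in> {c..<q} \<Longrightarrow> \<exists>e>0. \<exists>L. \<forall>x\<in>{s..s+e}. \<forall>y\<in>{s..s+e}. \<bar>h y - h x\<bar> \<le> L * \<bar>y - x\<bar>"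
    and f_meas: "set_borel_measurable borel {c..<q} f"
    and f_bdd: "\<And>s. s \<in> {c..<q} \<Longrightarrow> \<bar>f s\<bar> \<le> B"
    and t: "t \<in> {p..<q}" and f_cont: "continuous (at t within {p..<q}) f"
    and e: "e > 0"
    and h_lip: "\<And>x y. x \<in> {p..<q} \<Longrightarrow> \<bar>x - t\<bar> < e \<Longrightarrow> y \<in> {p..<q} \<Longrightarrow> \<bar>y - t\<bar> < e \<Longrightarrow>
                  \<bar>h y - h x\<bar> \<le> L * \<bar>y - x\<bar>"
    and h': "(h has_real_derivative h') (at t within {p..<q})"
  shows "((\<lambda>s. stieltjes_integral f h c s) has_real_derivative f t * h') (at t within {p..<q})"
proof -
  \<comment> \<open>The decomposition is taken on \<open>[c,t1]\<close> with \<open>t < t1 < q\<close>: it then serves both sides of \<open>t\<close>, while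
    the local Lipschitz bounds on \<open>h\<close> are available on \<open>[c,q)\<close> only.\<close>
  define t1 where "t1 = (t + q) / 2"
  have t1: "t < t1" "t1 < q" "t1 \<in> {c..d}" using t pq by (auto simp: t1_def)
  have "\<exists>e>0. \<exists>L. \<forall>x\<in>{s..s+e}. \<forall>y\<in>{s..s+e}. \<bar>h y - h x\<bar> \<le> L * \<bar>y - x\<bar>" if "s \<in> {c..<t1}" for s
    using that t1 by (intro right_lip) auto
  then obtain P Q where PQ: "mono P" "mono Q" "\<And>s. continuous (at_right s) P" "\<And>s. continuous (at_right s) Q"
    and h_eq: "\<And>s. s \<in> {c..t1} \<Longrightarrow> h s = P s - Q s"
    and slope: "\<And>x y L. c \<le> x \<Longrightarrow> x \<le> y \<Longrightarrow> y \<le> t1 \<Longrightarrow>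
       (\<And>r s. r \<in> {x..y} \<Longrightarrow> s \<in> {x..y} \<Longrightarrow> \<bar>h s - h r\<bar> \<le> L * \<bar>s - r\<bar>) \<Longrightarrow>
       P y - P x \<le> L * (y - x) \<and> Q y - Q x \<le> 2 * L * (y - x)"
    using jordan_decomposition[OF bv t1(3)] by blast
  have int: "set_integrable (interval_measure F) {x<..y} f"
    if F: "mono F" "\<And>s. continuous (at_right s) F" and xy: "c \<le> x" "y \<le> t1" for F x y
  proof (rule set_integrable_bound)
    show "set_integrable (interval_measure F) {x<..y} (\<lambda>_. B)"
      unfolding set_integrable_def
      by (simp add: emeasure_interval_measure_Ioc_eq[OF monoD[OF F(1)] F(2)])
    have "set_borel_measurable borel {x<..y} f"
      by (rule set_borel_measurable_subset[OF f_meas]) (use xy t1 in auto)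
    then show "set_borel_measurable (interval_measure F) {x<..y} f"
      by (simp add: set_borel_measurable_def)
    have "\<bar>f r\<bar> \<le> \<bar>B\<bar>" if "r \<in> {x<..y}" for r
      using f_bdd[of r] that xy t1 by auto
    then show "AE r in interval_measure F. r \<in> {x<..y} \<longrightarrow> norm (f r) \<le> norm B" by simp
  qed
  define I where "I s = (LINT r:{c<..s}|interval_measure P. f r) - (LINT r:{c<..s}|interval_measure Q. f r)" for s
  have I_eq: "stieltjes_integral f h c s = I s" if "s \<in> {c..t1}" for s
  proof -
    have "has_stieltjes_integral f h c s (I s)"
      unfolding has_stieltjes_integral_def I_def
      using PQ that h_eq int by (intro exI[of _ P] exI[of _ Q]) auto
    then show ?thesis
      unfolding stieltjes_integral_def by (blast intro: the_equality has_stieltjes_integral_unique)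
  qed
  have I_diff: "I y - I x = (LINT r:{x<..y}|interval_measure P. f r) - (LINT r:{x<..y}|interval_measure Q. f r)"
    if xy: "c \<le> x" "x \<le> y" "y \<le> t1" for x y
  proof -
    have "{c<..y} = {c<..x} \<union> {x<..y}" using xy by auto
    moreover have "{c<..x} \<inter> {x<..y} = {}" by auto
    ultimately show ?thesis
      unfolding I_def using xy PQ by (simp add: set_integral_Un int)
  qed
  have step: "\<bar>(I y - I x) - f t * (h y - h x)\<bar> \<le> \<epsilon> * (3 * L * (y - x))"
    if xy: "x \<in> {p..<q}" "y \<in> {p..<q}" "x \<le> y" "y \<le> t1" "\<bar>x - t\<bar> < e" "\<bar>y - t\<bar> < e"
      and \<epsilon>: "\<epsilon> \<ge> 0" "\<And>r. r \<in> {x<..y} \<Longrightarrow> \<bar>f r - f t\<bar> \<le> \<epsilon>" for x y \<epsilon>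
  proof -
    have c: "c \<le> x" using xy pq by simp
    have "\<bar>h r' - h r\<bar> \<le> L * \<bar>r' - r\<bar>" if "r \<in> {x..y}" "r' \<in> {x..y}" for r r'
      using that xy by (intro h_lip) auto
    from slope[OF c xy(3,4) this] have sl: "P y - P x \<le> L * (y - x)" "Q y - Q x \<le> 2 * L * (y - x)"
      by auto
    have "\<bar>(LINT r:{x<..y}|interval_measure P. f r) - f t * (P y - P x)\<bar> \<le> \<epsilon> * (P y - P x)"
      "\<bar>(LINT r:{x<..y}|interval_measure Q. f r) - f t * (Q y - Q x)\<bar> \<le> \<epsilon> * (Q y - Q x)"
      using c xy \<epsilon>(2) by (intro interval_measure_integral_deviation PQ int; simp)+
    moreover have "\<epsilon> * (P y - P x) \<le> \<epsilon> * (L * (y - x))" "\<epsilon> * (Q y - Q x) \<le> \<epsilon> * (2 * L * (y - x))"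
      using sl \<epsilon>(1) by (intro mult_left_mono; simp)+
    moreover have "f t * (h y - h x) = f t * (P y - P x) - f t * (Q y - Q x)"
    proof -
      have "h y - h x = (P y - P x) - (Q y - Q x)"
        using h_eq[of x] h_eq[of y] c xy by simp
      then show ?thesis by (simp only: right_diff_distrib)
    qed
    moreover have "\<epsilon> * (L * (y - x)) + \<epsilon> * (2 * L * (y - x)) = \<epsilon> * (3 * L * (y - x))"
      by (simp add: algebra_simps)
    ultimately show ?thesis
      unfolding I_diff[OF c xy(3,4)] by linarith
  qed
  have "((\<lambda>s. I s - f t * h s) has_derivative (\<lambda>_. 0)) (at t within {p..<q})"
    unfolding has_derivative_within_alt
  proof (intro conjI allI impI)
    fix \<epsilon>0 :: real assume \<epsilon>0: "\<epsilon>0 > 0"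
    define \<epsilon> where "\<epsilon> = \<epsilon>0 / (3 * \<bar>L\<bar> + 1)"
    have \<epsilon>: "\<epsilon> > 0" using \<epsilon>0 by (simp add: \<epsilon>_def add_nonneg_pos)
    obtain \<delta> where \<delta>: "\<delta> > 0" "\<And>r. r \<in> {p..<q} \<Longrightarrow> dist r t < \<delta> \<Longrightarrow> dist (f r) (f t) < \<epsilon>"
      using f_cont \<epsilon> unfolding continuous_within_eps_delta by blast
    define \<delta>' where "\<delta>' = min \<delta> (min e (t1 - t))"
    have \<delta>': "\<delta>' > 0" "\<delta>' \<le> \<delta>" "\<delta>' \<le> e" "\<delta>' \<le> t1 - t" using \<delta> e t1 by (auto simp: \<delta>'_def)
    have bound: "\<bar>(I y - I x) - f t * (h y - h x)\<bar> \<le> \<epsilon>0 * (y - x)"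
      if xy: "x \<in> {p..<q}" "y \<in> {p..<q}" "x \<le> y" "\<bar>x - t\<bar> < \<delta>'" "\<bar>y - t\<bar> < \<delta>'" for x y
    proof -
      have "\<bar>(I y - I x) - f t * (h y - h x)\<bar> \<le> \<epsilon> * (3 * L * (y - x))"
      proof (rule step)
        show "\<bar>f r - f t\<bar> \<le> \<epsilon>" if "r \<in> {x<..y}" for r
        proof -
          have "x < r" "r \<le> y" using that by auto
          then have "\<bar>r - t\<bar> < \<delta>" "r \<in> {p..<q}" using xy \<delta>' by auto
          then show ?thesis using \<delta>(2)[of r] by (simp add: dist_real_def)
        qed
      qed (use xy \<delta>' \<epsilon> in auto)
      also have "\<dots> = (\<epsilon> * (3 * L)) * (y - x)" by simp
      also have "\<dots> \<le> \<epsilon>0 * (y - x)"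
      proof (rule mult_right_mono)
        have "\<epsilon> * (3 * L) \<le> \<epsilon> * (3 * \<bar>L\<bar> + 1)" using \<epsilon> by (intro mult_left_mono) auto
        also have "\<dots> = \<epsilon>0" unfolding \<epsilon>_def by (simp add: add_nonneg_eq_0_iff)
        finally show "\<epsilon> * (3 * L) \<le> \<epsilon>0" .
      qed (use xy in simp)
      finally show ?thesis .
    qed
    show "\<exists>d>0. \<forall>s\<in>{p..<q}. norm (s - t) < d \<longrightarrow>
        norm (I s - f t * h s - (I t - f t * h t) - 0) \<le> \<epsilon>0 * norm (s - t)"
    proof (intro exI[of _ \<delta>'] conjI ballI impI \<delta>'(1))
      fix s assume s: "s \<in> {p..<q}" "norm (s - t) < \<delta>'"
      have eq: "I s - f t * h s - (I t - f t * h t) = (I s - I t) - f t * (h s - h t)"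
        "I s - f t * h s - (I t - f t * h t) = - ((I t - I s) - f t * (h t - h s))"
        by (simp_all add: algebra_simps)
      show "norm (I s - f t * h s - (I t - f t * h t) - 0) \<le> \<epsilon>0 * norm (s - t)"
      proof (cases "t \<le> s")
        case True
        then show ?thesis using bound[OF t s(1)] s(2) \<delta>'(1) unfolding eq(1) by simp
      next
        case False
        then show ?thesis using bound[OF s(1) t] s(2) \<delta>'(1) unfolding eq(2) by simp
      qed
    qed
  qed simp
  then have "((\<lambda>s. I s - f t * h s) has_real_derivative 0) (at t within {p..<q})"
    unfolding has_field_derivative_def by (rule has_derivative_eq_rhs) auto
  from DERIV_add[OF this DERIV_cmult[OF h', of "f t"]]
  have "(I has_real_derivative f t * h') (at t within {p..<q})" by simp
  then show ?thesis
    by (rule has_field_derivative_transform_within[where d = "t1 - t"])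
      (use t t1 pq I_eq in \<open>auto simp: dist_real_def\<close>)
qed

section \<open>The time derivative of the Stieltjes coefficients\<close>

lemma continuity_partition_strict:
  assumes "continuity_partition u T N \<tau>"
  shows "\<And>i. i < N \<Longrightarrow> \<tau> i < \<tau> (Suc i)" "\<And>i. i \<le> N \<Longrightarrow> 0 \<le> \<tau> i" "\<And>i. i \<le> N \<Longrightarrow> \<tau> i \<le> T"
proof -
  show less: "\<tau> i < \<tau> (Suc i)" if "i < N" for i
    using assms that by (auto simp: continuity_partition_def)
  show "0 \<le> \<tau> i" if "i \<le> N" for i
    using that
  proof (induction i)
    case (Suc i)
    with less[of i] show ?case by simp
  qed (use assms in \<open>simp add: continuity_partition_def\<close>)
  show "\<tau> i \<le> T" if "i \<le> N" for i
    using that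
  proof (induction "N - i" arbitrary: i)
    case 0
    then show ?case using assms by (simp add: continuity_partition_def)
  next
    case (Suc d)
    then have "\<tau> (Suc i) \<le> T" by (intro Suc.hyps(1)) auto
    moreover have "i < N" using Suc.hyps(2) by linarith
    ultimately show ?case using less[of i] by simp
  qed
qed

lemma piece_exists:
  fixes \<tau> :: "nat \<Rightarrow> real"
  assumes "s \<in> {\<tau> 0..<\<tau> n}"
  shows "\<exists>i<n. s \<in> {\<tau> i..<\<tau> (Suc i)}"
  using assms
proof (induction n)
  case (Suc n)
  show ?case
  proof (cases "s < \<tau> n")
    case True
    with Suc show ?thesis by (auto intro: less_SucI)
  next
    case False
    with Suc.prems show ?thesis by auto
  qed
qed simp

lemma set_borel_measurable_pieces:
  fixes f :: "real \<Rightarrow> real" and \<tau> :: "nat \<Rightarrow> real"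
  assumes "\<And>i. i < n \<Longrightarrow> \<tau> i < \<tau> (Suc i)" and "\<And>i. i < n \<Longrightarrow> continuous_on {\<tau> i..<\<tau> (Suc i)} f"
  shows "set_borel_measurable borel {\<tau> 0..<\<tau> n} f"
  using assms
proof (induction n)
  case 0
  then show ?case by (simp add: set_borel_measurable_def)
next
  case (Suc n)
  have le: "\<tau> 0 \<le> \<tau> n" using Suc.prems(1)
    by (induction n) (auto, meson le_less_trans less_SucI less_imp_le not_le lessI order_trans)
  have "(\<lambda>x. indicat_real {\<tau> 0..<\<tau> n} x *\<^sub>R f x + indicat_real {\<tau> n..<\<tau> (Suc n)} x *\<^sub>R f x) \<in> borel_measurable borel"
    using Suc.IH[OF Suc.prems(1,2)] set_measurable_continuous_on[OF _ Suc.prems(2)[of n]]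
    unfolding set_borel_measurable_def by (intro borel_measurable_add) auto
  also have "(\<lambda>x. indicat_real {\<tau> 0..<\<tau> n} x *\<^sub>R f x + indicat_real {\<tau> n..<\<tau> (Suc n)} x *\<^sub>R f x) =
      (\<lambda>x. indicat_real {\<tau> 0..<\<tau> (Suc n)} x *\<^sub>R f x)"
    using le Suc.prems(1)[of n] by (auto simp: indicator_def)
  finally show ?case by (simp add: set_borel_measurable_def)
qed

lemma C1_piece:
  fixes u :: "real \<Rightarrow> real^'n \<Rightarrow> real^'m"
  assumes u: "Ck_on 1 ({p..<q} \<times> UNIV) (\<lambda>(t, l). u t l)"
  obtains u' where "\<And>t l. t \<in> {p..<q} \<Longrightarrow> ((\<lambda>(t, l). u t l) has_derivative u' (t, l)) (at (t, l) within {p..<q} \<times> UNIV)"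
    "\<And>t l. t \<in> {p..<q} \<Longrightarrow> ((\<lambda>t. u t l) has_vector_derivative u' (t, l) (1, 0)) (at t within {p..<q})"
    "\<And>l. continuous_on {p..<q} (\<lambda>t. u' (t, l) (1, 0))"
proof -
  from u obtain u' where u': "\<And>z. z \<in> {p..<q} \<times> UNIV \<Longrightarrow> ((\<lambda>(t, l). u t l) has_derivative u' z) (at z within {p..<q} \<times> UNIV)"
    "\<And>v. continuous_on ({p..<q} \<times> UNIV) (\<lambda>z. u' z v)"
    unfolding One_nat_def Ck_on.simps by blast
  have 1: "((\<lambda>t. u t l) has_vector_derivative u' (t, l) (1, 0)) (at t within {p..<q})" if t: "t \<in> {p..<q}" for t l
  proof -
    have "((\<lambda>t. (t, l)) has_vector_derivative (1, 0)) (at t within {p..<q})"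
      by (auto intro!: derivative_eq_intros has_vector_derivative_Pair)
    moreover have "((\<lambda>(t, l). u t l) has_derivative u' (t, l)) (at (t, l) within (\<lambda>t. (t, l)) ` {p..<q})"
      by (rule has_derivative_subset[OF u'(1)]) (use t in auto)
    ultimately show ?thesis
      using vector_derivative_diff_chain_within by (fastforce simp: o_def)
  qed
  have 2: "continuous_on {p..<q} (\<lambda>t. u' (t, l) (1, 0))" for l
    by (rule continuous_on_compose2[OF u'(2)]) (auto intro!: continuous_intros)
  show ?thesis using that u'(1) 1 2 by blast
qed

lemma C1_piece_lipschitz:
  fixes h h' :: "real \<Rightarrow> real"
  assumes h: "\<And>t. t \<in> {p..<q} \<Longrightarrow> (h has_real_derivative h' t) (at t within {p..<q})"
    and h': "continuous_on {p..<q} h'" and xy: "p \<le> x" "y < q"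
  obtains L where "\<And>r s. r \<in> {x..y} \<Longrightarrow> s \<in> {x..y} \<Longrightarrow> \<bar>h s - h r\<bar> \<le> L * \<bar>s - r\<bar>"
proof -
  have sub: "{x..y} \<subseteq> {p..<q}" using xy by auto
  have "bounded (h' ` {x..y})"
    by (intro compact_imp_bounded compact_continuous_image continuous_on_subset[OF h' sub]) auto
  then obtain L where L: "\<And>s. s \<in> {x..y} \<Longrightarrow> norm (h' s) \<le> L" unfolding bounded_iff by blast
  have "norm (h s - h r) \<le> L * norm (s - r)" if "r \<in> {x..y}" "s \<in> {x..y}" for r s
  proof (rule field_differentiable_bound[OF convex_real_interval(5) _ L that(2,1)])
    show "(h has_field_derivative h' z) (at z within {x..y})" if "z \<in> {x..y}" for z
      by (rule DERIV_subset[OF h sub]) (use that sub in blast)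
  qed
  then show ?thesis using that unfolding real_norm_def by blast
qed

text \<open>
  For fixed \<open>\<lambda>\<close>, integrand and integrator are continuous and continuously differentiable, respectively,
  on each continuity interval. Earlier continuity intervals matter only for the integral to exist: they
  contribute a constant.
\<close>

lemma beta_has_derivative:
  fixes u :: "real \<Rightarrow> real^'n \<Rightarrow> (real, 'm::{finite,linorder}) vec"
  assumes rep: "algebraic_representation g G a S b"
    and adm: "admissible a K u"
    and bv: "\<And>i l. bounded_variation_on 0 T (\<lambda>t. u t l $ i)"
    and part: "continuity_partition u T N \<tau>"
    and pieces: "\<And>k. k < N \<Longrightarrow> Ck_on 1 ({\<tau> k..<\<tau> (Suc k)} \<times> UNIV) (\<lambda>(t, l). u t l)"
    and k: "k < N" and t: "t \<in> {\<tau> k..<\<tau> (Suc k)}"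
    and w: "((\<lambda>t. u t l) has_vector_derivative w) (at t within {\<tau> k..<\<tau> (Suc k)})"
  shows "((\<lambda>s. beta b u i s l) has_real_derivative (\<Sum>j\<in>UNIV. b j (u t l) $ i * w $ j))
    (at t within {\<tau> k..<\<tau> (Suc k)})"
  unfolding beta_def
proof (rule DERIV_sum)
  fix j :: 'm
  note strict = continuity_partition_strict[OF part]
  have \<tau>0: "\<tau> 0 = 0" using part by (simp add: continuity_partition_def)
  define h where "h s = u s l $ j" for s
  define f where "f s = b j (u s l) $ i" for s
  have box: "u s l \<in> cbox (- a) a" if "s \<ge> 0" for s
    using adm that by (simp add: admissible_def)
  have b_cont: "continuous_on (cbox (- a) a) (\<lambda>p. b j p $ i)"
  proof -
    have "Ck_on 0 (cbox (- a) a) (b j)"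
      using rep unfolding algebraic_representation_def smooth_on_def by blast
    then show ?thesis by (auto intro!: continuous_intros)
  qed
  have h_deriv: "\<exists>h'. (\<forall>s\<in>{\<tau> n..<\<tau> (Suc n)}. (h has_real_derivative h' s) (at s within {\<tau> n..<\<tau> (Suc n)}))
      \<and> continuous_on {\<tau> n..<\<tau> (Suc n)} h'" if "n < N" for n
  proof (rule C1_piece[OF pieces[OF that]])
    fix u' assume u': "\<And>t l. t \<in> {\<tau> n..<\<tau> (Suc n)} \<Longrightarrow>
        ((\<lambda>t. u t l) has_vector_derivative u' (t, l) (1, 0)) (at t within {\<tau> n..<\<tau> (Suc n)})"
      "\<And>l. continuous_on {\<tau> n..<\<tau> (Suc n)} (\<lambda>t. u' (t, l) (1, 0))"
    show ?thesis
    proof (intro exI conjI ballI)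
      show "(h has_real_derivative u' (s, l) (1, 0) $ j) (at s within {\<tau> n..<\<tau> (Suc n)})"
        if "s \<in> {\<tau> n..<\<tau> (Suc n)}" for s
        unfolding h_def has_real_derivative_iff_has_vector_derivative
        by (rule bounded_linear.has_vector_derivative[OF bounded_linear_vec_nth u'(1)[OF that]])
      show "continuous_on {\<tau> n..<\<tau> (Suc n)} (\<lambda>s. u' (s, l) (1, 0) $ j)"
        by (intro continuous_intros u'(2))
    qed
  qed
  have f_cont: "continuous_on {\<tau> n..<\<tau> (Suc n)} f" if "n < N" for n
  proof -
    have "continuous_on {\<tau> n..<\<tau> (Suc n)} (\<lambda>s. u s l)"
      using part that by (auto simp: continuity_partition_def)
    then show ?thesis
      unfolding f_def using strict(2)[of n] that
      by (intro continuous_on_compose2[OF b_cont]) (auto intro!: box)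
  qed
  have "bounded ((\<lambda>p. b j p $ i) ` cbox (- a) a)"
    by (intro compact_imp_bounded compact_continuous_image b_cont compact_cbox)
  then obtain B where B: "\<And>p. p \<in> cbox (- a) a \<Longrightarrow> norm (b j p $ i) \<le> B" unfolding bounded_iff by blast
  obtain h'k where h'k: "\<And>s. s \<in> {\<tau> k..<\<tau> (Suc k)} \<Longrightarrow> (h has_real_derivative h'k s) (at s within {\<tau> k..<\<tau> (Suc k)})"
    "continuous_on {\<tau> k..<\<tau> (Suc k)} h'k" using h_deriv[OF k] by blast
  define e where "e = (\<tau> (Suc k) - t) / 2"
  have e: "e > 0" "t + e < \<tau> (Suc k)" using t by (auto simp: e_def field_simps)
  obtain L where L: "\<And>r s. r \<in> {\<tau> k..t + e} \<Longrightarrow> s \<in> {\<tau> k..t + e} \<Longrightarrow> \<bar>h s - h r\<bar> \<le> L * \<bar>s - r\<bar>"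
    using C1_piece_lipschitz[OF h'k order_refl e(2)] by blast
  have "((\<lambda>s. stieltjes_integral f h 0 s) has_real_derivative f t * w $ j) (at t within {\<tau> k..<\<tau> (Suc k)})"
  proof (rule stieltjes_integral_has_derivative)
    show "bounded_variation_on 0 T h" unfolding h_def by (rule bv)
    show "0 \<le> \<tau> k" "\<tau> (Suc k) \<le> T" using strict k by auto
    show "\<exists>e>0. \<exists>L. \<forall>x\<in>{s..s + e}. \<forall>y\<in>{s..s + e}. \<bar>h y - h x\<bar> \<le> L * \<bar>y - x\<bar>" if s: "s \<in> {0..<\<tau> (Suc k)}" for s
    proof -
      obtain n where n: "n < Suc k" "s \<in> {\<tau> n..<\<tau> (Suc n)}"
        using piece_exists[of s \<tau> "Suc k"] s \<tau>0 by auto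
      then have "n < N" using k by simp
      then obtain h' where h': "\<And>s. s \<in> {\<tau> n..<\<tau> (Suc n)} \<Longrightarrow> (h has_real_derivative h' s) (at s within {\<tau> n..<\<tau> (Suc n)})"
        "continuous_on {\<tau> n..<\<tau> (Suc n)} h'" using h_deriv[of n] by blast
      define d where "d = (\<tau> (Suc n) - s) / 2"
      have d: "d > 0" "\<tau> n \<le> s" "s + d < \<tau> (Suc n)" using n by (auto simp: d_def field_simps)
      obtain L where "\<And>r r'. r \<in> {s..s + d} \<Longrightarrow> r' \<in> {s..s + d} \<Longrightarrow> \<bar>h r' - h r\<bar> \<le> L * \<bar>r' - r\<bar>"
        using C1_piece_lipschitz[OF h' d(2,3)] by blast
      with d(1) show ?thesis by blast
    qed
    show "set_borel_measurable borel {0..<\<tau> (Suc k)} f"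
      using set_borel_measurable_pieces[of "Suc k" \<tau> f] strict(1) f_cont k \<tau>0 by auto
    show "\<bar>f s\<bar> \<le> B" if "s \<in> {0..<\<tau> (Suc k)}" for s
      using B[OF box] that by (simp add: f_def)
    show "t \<in> {\<tau> k..<\<tau> (Suc k)}" by (rule t)
    show "continuous (at t within {\<tau> k..<\<tau> (Suc k)}) f"
      using f_cont[OF k] t by (simp add: continuous_on_eq_continuous_within)
    show "e > 0" by (rule e)
    show "\<bar>h y - h x\<bar> \<le> L * \<bar>y - x\<bar>"
      if "x \<in> {\<tau> k..<\<tau> (Suc k)}" "\<bar>x - t\<bar> < e" "y \<in> {\<tau> k..<\<tau> (Suc k)}" "\<bar>y - t\<bar> < e" for x y
      using that by (intro L) auto
    show "(h has_real_derivative w $ j) (at t within {\<tau> k..<\<tau> (Suc k)})"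
      unfolding h_def has_real_derivative_iff_has_vector_derivative
      by (rule bounded_linear.has_vector_derivative[OF bounded_linear_vec_nth w])
  qed
  then show "((\<lambda>s. alpha b u i j s l) has_real_derivative b j (u t l) $ i * w $ j) (at t within {\<tau> k..<\<tau> (Suc k)})"
    unfolding alpha_def f_def[abs_def] h_def[abs_def] .
qed

section \<open>The equation satisfied by the implicit solution\<close>

theorem theorem3p4:
  fixes g0 :: "real^'n \<Rightarrow> real^'n"
    and g :: "'m::{finite,linorder} \<Rightarrow> real^'n \<Rightarrow> real^'n"
    and G0 :: "real \<Rightarrow> real^'n \<Rightarrow> real^'n"
    and G :: "'m \<Rightarrow> real \<Rightarrow> real^'n \<Rightarrow> real^'n"
    and xs :: "real^'n" and \<gamma> T K1 C1 C2 \<rho> :: real and a :: "(real, 'm) vec"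
    and b :: "'m \<Rightarrow> (real, 'm) vec \<Rightarrow> (real, 'm) vec"
    and u :: "real \<Rightarrow> real^'n \<Rightarrow> (real, 'm) vec"
    and N :: nat and \<tau> :: "nat \<Rightarrow> real"
  assumes smooth: "smooth_on UNIV g0" "\<And>i. smooth_on UNIV (g i)"
    and flows: "is_flow g0 G0" "\<And>i. is_flow (g i) (G i)"
    and pos: "\<gamma> > 0" "T > 0" "\<And>i. a $ i > 0" "K1 > 0"
    and invol: "real_involution_on (cball xs (3 * \<gamma>)) g"
    and commute: "\<And>i x. x \<in> cball xs (3 * \<gamma>) \<Longrightarrow> lie_bracket g0 (g i) x = 0"
    and rep: "algebraic_representation g G a (cball xs (2 * \<gamma>)) b"
    and adm: "admissible a K1 u"
    and bv: "\<And>i l. bounded_variation_on 0 T (\<lambda>t. u t l $ i)"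
    and disp0: "\<And>x t. x \<in> cball xs (3 * \<gamma>) \<Longrightarrow> \<bar>t\<bar> \<le> T \<Longrightarrow>
                  norm (G0 t x - x) \<le> \<gamma> / (2 * (real CARD('m) + 1))"
    and disp: "\<And>x i t. x \<in> cball xs (3 * \<gamma>) \<Longrightarrow> \<bar>t\<bar> \<le> a $ i \<Longrightarrow>
                  norm (G i t x - x) \<le> \<gamma> / (2 * (real CARD('m) + 1))"
    and C1: "C1 \<in> {norm (jacobian (inv_comp_flow G p) (at y) *v g i y) | p y i.
                      p \<in> cbox (-a) a \<and> y \<in> cball xs (2 * \<gamma>)}"
            "\<And>p y i. p \<in> cbox (-a) a \<Longrightarrow> y \<in> cball xs (2 * \<gamma>) \<Longrightarrow>
                      norm (jacobian (inv_comp_flow G p) (at y) *v g i y) \<le> C1"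
    and C2: "C2 \<in> {entry_norm (rep_matrix b p) | p. p \<in> cbox (-a) a}"
            "\<And>p. p \<in> cbox (-a) a \<Longrightarrow> entry_norm (rep_matrix b p) \<le> C2"
    and contraction: "C1 * C2 * K1 = \<rho>" "\<rho> \<in> {0..1/2}"
    and partition: "continuity_partition u T N \<tau>"
    and C1_pieces: "\<And>k. k < N \<Longrightarrow>
                      Ck_on 1 ({\<tau> k..<\<tau> (Suc k)} \<times> UNIV) (\<lambda>(t, l). u t l)"
  defines "\<psi> \<equiv> psi G0 G u (cball xs (2 * \<gamma>))"
  shows "\<forall>k<N. \<forall>t\<in>{\<tau> k..<\<tau> (Suc k)}. \<forall>x\<in>ball xs \<gamma>.
           (\<exists>!l. solves G0 G u (cball xs (2 * \<gamma>)) t x l) \<and>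
           (\<lambda>s. \<psi> s x) differentiable (at t within {\<tau> k..<\<tau> (Suc k)}) \<and>
           \<psi> t differentiable (at x) \<and>
           (\<forall>i. (\<lambda>s. beta b u i s (\<psi> t x)) differentiable (at t within {\<tau> k..<\<tau> (Suc k)})) \<and>
           vector_derivative (\<lambda>s. \<psi> s x) (at t within {\<tau> k..<\<tau> (Suc k)})
             + jacobian (\<psi> t) (at x) *v
                 (g0 x + (\<Sum>i\<in>UNIV.
                    vector_derivative (\<lambda>s. beta b u i s (\<psi> t x)) (at t within {\<tau> k..<\<tau> (Suc k)})
                      *\<^sub>R g i x)) = 0"
proof (intro allI impI ballI)
  fix k t x
  assume k: "k < N" and t: "t \<in> {\<tau> k..<\<tau> (Suc k)}" and x: "x \<in> ball xs \<gamma>"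
  define I where "I = {\<tau> k..<\<tau> (Suc k)}"
  define S where "S = cball xs (2 * \<gamma>)"
  have tI: "t \<in> I" using t by (simp add: I_def)
  have "\<forall>i. \<exists>DX. C1_flow (g i) DX (G i)"
    using smooth_flow_C1_flow[OF smooth(2) flows(2)] by metis
  then obtain Dg where Dg: "\<And>i. C1_flow (g i) (Dg i) (G i)" by metis
  obtain Dg0 where Dg0: "C1_flow g0 Dg0 G0" using smooth_flow_C1_flow[OF smooth(1) flows(1)] by metis
  interpret g0: C1_flow g0 Dg0 G0 by (rule Dg0)
  note G_inv = C1_flow.flow_inverse[OF Dg]
  note G_diff = C1_flow.flow_jointly_differentiable[OF Dg]
  have u_box: "u s l \<in> cbox (- a) a" if "s \<in> I" for s l
    using adm that continuity_partition_strict(2)[OF partition, of k] k by (simp add: admissible_def I_def)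
  have I_T: "0 \<le> s" "s \<le> T" if "s \<in> I" for s
    using that continuity_partition_strict(2)[OF partition, of k]
      continuity_partition_strict(3)[OF partition, of "Suc k"] k by (auto simp: I_def)
  define d where "d = \<gamma> / (2 * (real CARD('m) + 1))"
  have d: "d \<ge> 0" "real CARD('m) * d + d = \<gamma> / 2"
  proof -
    have "d * (2 * (real CARD('m) + 1)) = \<gamma>" by (simp add: d_def)
    then show "real CARD('m) * d + d = \<gamma> / 2" by (simp add: algebra_simps)
    show "d \<ge> 0" using pos(1) by (simp add: d_def)
  qed
  have d_le: "d \<le> \<gamma> / 2"
  proof -
    have "real CARD('m) * d \<ge> 0" using d(1) by simp
    then show ?thesis using d(2) by linarith
  qed
  have y_near: "dist xs (G0 (- s) z) \<le> dist xs z + d" if "s \<in> I" "z \<in> ball xs \<gamma>" for s z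
  proof -
    have "norm (G0 (- s) z - z) \<le> d"
      unfolding d_def using that I_T[OF that(1)] pos(1) by (intro disp0) auto
    then show ?thesis using dist_triangle[of xs "G0 (- s) z" z] by (simp add: dist_norm norm_minus_commute)
  qed
  have y_S: "G0 (- s) z \<in> S" if "s \<in> I" "z \<in> ball xs \<gamma>" for s z
    using y_near[OF that] that(2) d_le pos(1) by (simp add: S_def)
  have inv_S: "inv_comp_flow G p (G0 (- s) z) \<in> S" if "s \<in> I" "z \<in> ball xs \<gamma>" "p \<in> cbox (- a) a" for s z p
  proof -
    have near: "dist xs (G0 (- s) z) + real CARD('m) * d \<le> 3 / 2 * \<gamma>"
      using y_near[OF that(1,2)] that(2) d by simp
    have "norm (inv_comp_flow G p (G0 (- s) z) - G0 (- s) z) \<le> real CARD('m) * d"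
      by (rule inv_comp_flow_displacement[OF disp[folded d_def] that(3) _ d(1)])
        (use near pos(1) in auto)
    then have "dist xs (inv_comp_flow G p (G0 (- s) z)) \<le> 3 / 2 * \<gamma>"
      using near dist_triangle[of xs "inv_comp_flow G p (G0 (- s) z)" "G0 (- s) z"]
      by (simp add: dist_norm norm_minus_commute)
    then show ?thesis using pos(1) by (simp add: S_def)
  qed
  \<comment> \<open>The equation for \<open>\<psi>\<close> in fixed-point form.\<close>
  define F where "F = (\<lambda>((s, z), l). inv_comp_flow G (u s l) (G0 (- s) z))"
  have contr: "norm (F ((s, z), l) - F ((s, z), l')) \<le> \<rho> * norm (l - l')"
    if s: "s \<in> I" and z: "z \<in> ball xs \<gamma>" for s z l l'
    unfolding F_def prod.case contraction(1)[symmetric]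
  proof (rule perturbed_inverse_contraction[OF rep pos(3) _ _ _ _ _ C2(2)])
    show "inv_comp_flow G p (G0 (- s) z) \<in> cball xs (2 * \<gamma>)" if "p \<in> cbox (- a) a" for p
      using inv_S[OF s z that] by (simp add: S_def)
    show "norm (jacobian (inv_comp_flow G p) (at (G0 (- s) z)) *v g i (G0 (- s) z)) \<le> C1"
      if "p \<in> cbox (- a) a" for p i
      using y_S[OF s z] that by (intro C1(2)) (auto simp: S_def)
    show "u s l \<in> cbox (- a) a" for l by (rule u_box[OF s])
    show "u s differentiable (at l)" for l
    proof -
      have "Ck_on (Suc 0) UNIV (u s)"
        using adm I_T[OF s] unfolding admissible_def C1_bounded_def One_nat_def by blast
      then show ?thesis by (auto simp: differentiable_def)
    qed
    show "\<exists>D. GDERIV (\<lambda>l. u s l $ i) l :> D \<and> norm D \<le> K1" for l i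
      using adm I_T[OF s] unfolding admissible_def by blast
  qed (use G_inv G_diff pos in auto)
  have ex1_fixed: "\<exists>!l. F ((s, z), l) = l" if "s \<in> I" "z \<in> ball xs \<gamma>" for s z
  proof (rule banach_fix_type)
    show "0 \<le> \<rho>" "\<rho> < 1" using contraction(2) by auto
    show "\<forall>l l'. dist (F ((s, z), l)) (F ((s, z), l')) \<le> \<rho> * dist l l'"
      using contr[OF that] by (simp add: dist_norm)
  qed
  have solves_iff: "solves G0 G u S s z l \<longleftrightarrow> F ((s, z), l) = l" if "s \<in> I" "z \<in> ball xs \<gamma>" for s z l
  proof
    assume "solves G0 G u S s z l"
    then have "G0 (- s) z = comp_flow G (u s l) l"
      unfolding solves_def using g0.flow_inverse(1) by metis
    then show "F ((s, z), l) = l" by (simp add: F_def inv_comp_flow_comp_flow G_inv)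
  next
    assume l: "F ((s, z), l) = l"
    then have "l \<in> S" using inv_S[OF that u_box[OF that(1)], of l] by (simp add: F_def)
    moreover have "comp_flow G (u s l) l = G0 (- s) z"
      using l comp_flow_inv_comp_flow[of G "u s l" "G0 (- s) z"] G_inv by (simp add: F_def)
    ultimately show "solves G0 G u S s z l" by (simp add: solves_def g0.flow_inverse)
  qed
  have ex1: "\<exists>!l. solves G0 G u S s z l" if "s \<in> I" "z \<in> ball xs \<gamma>" for s z
    using ex1_fixed[OF that] solves_iff[OF that] by simp
  have psi_solves: "solves G0 G u S s z (\<psi> s z)" if "s \<in> I" "z \<in> ball xs \<gamma>" for s z
    unfolding \<psi>_def psi_def S_def[symmetric] by (rule theI'[OF ex1[OF that]])
  have psi_fixed: "F ((s, z), \<psi> s z) = \<psi> s z" if "s \<in> I" "z \<in> ball xs \<gamma>" for s z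
    using psi_solves[OF that] solves_iff[OF that] by simp
  define l0 where "l0 = \<psi> t x"
  define p0 where "p0 = u t l0"
  define y0 where "y0 = comp_flow G p0 l0"
  have l0: "l0 \<in> S" "G0 t y0 = x"
    using psi_solves[OF tI x] by (auto simp: solves_def l0_def p0_def y0_def)
  have p0: "p0 \<in> cbox (- a) a" unfolding p0_def by (rule u_box[OF tI])
  obtain u' where u': "\<And>t l. t \<in> I \<Longrightarrow> ((\<lambda>(t, l). u t l) has_derivative u' (t, l)) (at (t, l) within I \<times> UNIV)"
    "\<And>t l. t \<in> I \<Longrightarrow> ((\<lambda>t. u t l) has_vector_derivative u' (t, l) (1, 0)) (at t within I)"
    unfolding I_def by (rule C1_piece[OF C1_pieces[OF k]]) blast

  have "F differentiable (at ((t, x), l0) within (I \<times> ball xs \<gamma>) \<times> UNIV)"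
  proof -
    let ?A = "(I \<times> ball xs \<gamma>) \<times> (UNIV :: (real^'n) set)"
    have proj: "(\<lambda>z. (fst (fst z), snd z)) differentiable (at ((t, x), l0) within ?A)"
      by (intro bounded_linear_imp_differentiable bounded_linear_intros)
    have "(\<lambda>(t, l). u t l) differentiable
        (at (fst (fst ((t, x), l0)), snd ((t, x), l0)) within (\<lambda>z. (fst (fst z), snd z)) ` ?A)"
    proof (rule differentiable_within_subset)
      show "(\<lambda>(t, l). u t l) differentiable
          (at (fst (fst ((t, x), l0)), snd ((t, x), l0)) within I \<times> UNIV)"
        using u'(1)[OF tI, of l0] by (auto simp: differentiable_def)
    qed auto
    from differentiable_in_compose[OF this proj]
    have "(\<lambda>z. u (fst (fst z)) (snd z)) differentiable (at ((t, x), l0) within ?A)" by simp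
    moreover have "(\<lambda>z. G0 (- fst (fst z)) (snd (fst z))) differentiable (at ((t, x), l0) within ?A)"
    proof -
      have "(\<lambda>z. (- fst (fst z), snd (fst z))) differentiable (at ((t, x), l0) within ?A)"
        by (intro bounded_linear_imp_differentiable bounded_linear_intros bounded_linear_minus)
      from differentiable_compose[OF g0.flow_jointly_differentiable this] show ?thesis by simp
    qed
    ultimately have "(\<lambda>z. (u (fst (fst z)) (snd z), G0 (- fst (fst z)) (snd (fst z))))
        differentiable (at ((t, x), l0) within ?A)"
      by (rule differentiable_Pair)
    from differentiable_compose[OF inv_comp_flow_jointly_differentiable[OF G_diff] this] show ?thesis
      by (simp add: F_def case_prod_unfold)
  qed
  then have "(\<lambda>(s, z). \<psi> s z) differentiable (at (t, x) within I \<times> ball xs \<gamma>)"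
    using contraction(2) tI x
    by (intro fixed_point_differentiable[where F = F and c = \<rho>])
      (auto simp: psi_fixed contr l0_def)
  then obtain L where L: "((\<lambda>(s, z). \<psi> s z) has_derivative L) (at (t, x) within I \<times> ball xs \<gamma>)"
    by (auto simp: differentiable_def)
  interpret L: bounded_linear L by (rule has_derivative_bounded_linear[OF L])
  have psi_t: "((\<lambda>s. \<psi> s x) has_vector_derivative L (1, 0)) (at t within I)"
  proof -
    have "((\<lambda>s. (s, x)) has_vector_derivative (1, 0)) (at t within I)"
      by (auto intro!: derivative_eq_intros has_vector_derivative_Pair)
    moreover have "((\<lambda>(s, z). \<psi> s z) has_derivative L) (at (t, x) within (\<lambda>s. (s, x)) ` I)"
      by (rule has_derivative_subset[OF L]) (use x in auto)
    ultimately show ?thesis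
      using vector_derivative_diff_chain_within by (fastforce simp: o_def)
  qed
  have at_x: "at x within ball xs \<gamma> = at x" using x by (intro at_within_open) auto
  have psi_x: "(\<psi> t has_derivative (\<lambda>v. L (0, v))) (at x)"
  proof -
    have "((\<lambda>z. (t, z)) has_derivative (\<lambda>v. (0, v))) (at x within ball xs \<gamma>)"
      by (auto intro!: derivative_eq_intros)
    moreover have "((\<lambda>(s, z). \<psi> s z) has_derivative L) (at (t, x) within (\<lambda>z. (t, z)) ` ball xs \<gamma>)"
      by (rule has_derivative_subset[OF L]) (use tI in auto)
    ultimately show ?thesis
      unfolding at_x[symmetric] using has_derivative_in_compose by fastforce
  qed

  obtain Cd where Cd: "((\<lambda>(p, l). comp_flow G p l) has_derivative Cd) (at (p0, l0))"
    using comp_flow_jointly_differentiable[of G p0 l0] G_diff by (auto simp: differentiable_def)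
  obtain E where E: "((\<lambda>(s, y). G0 s y) has_derivative E) (at (t, y0))"
    using g0.flow_jointly_differentiable by (auto simp: differentiable_def)
  interpret E: bounded_linear E by (rule has_derivative_bounded_linear[OF E])
  \<comment> \<open>The derivative of \<open>\<Theta>(s,\<lambda>) = G\<^sub>0(s)[G(u(s,\<lambda>))[\<lambda>]]\<close> at \<open>(t,\<lambda>\<^sub>0)\<close>; \<open>L\<close> is that of \<open>\<psi>\<close> at \<open>(t,x)\<close>.\<close>
  define M where "M = (\<lambda>z. E (fst z, Cd (u' (t, l0) z, snd z)))"
  have M: "((\<lambda>z. G0 (fst z) (comp_flow G (u (fst z) (snd z)) (snd z))) has_derivative M)
      (at (t, l0) within I \<times> UNIV)"
  proof -
    have fst_d: "(fst has_derivative fst) (at (t, l0) within I \<times> UNIV)"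
      and snd_d: "(snd has_derivative snd) (at (t, l0) within I \<times> UNIV)"
      by (auto intro!: derivative_eq_intros)
    have "((\<lambda>z. u (fst z) (snd z)) has_derivative u' (t, l0)) (at (t, l0) within I \<times> UNIV)"
      using u'(1)[OF tI, of l0] by (simp add: case_prod_unfold)
    from has_derivative_Pair[OF this snd_d]
    have "((\<lambda>z. comp_flow G (u (fst z) (snd z)) (snd z)) has_derivative (\<lambda>z. Cd (u' (t, l0) z, snd z)))
        (at (t, l0) within I \<times> UNIV)"
      using has_derivative_compose[where g = "\<lambda>(p, l). comp_flow G p l" and g' = Cd] Cd
      by (fastforce simp: p0_def)
    from has_derivative_Pair[OF fst_d this] show ?thesis
      using has_derivative_compose[where g = "\<lambda>(s, y). G0 s y" and g' = E] E
      by (fastforce simp: p0_def y0_def M_def)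
  qed
  interpret M: bounded_linear M by (rule has_derivative_bounded_linear[OF M])
  have \<Theta>: "G0 s (comp_flow G (u s (\<psi> s z)) (\<psi> s z)) = z" if "s \<in> I" "z \<in> ball xs \<gamma>" for s z
    using psi_solves[OF that] by (simp add: solves_def)
  have nontrivial: "at t within I \<noteq> bot"
  proof -
    have "t islimpt {t<..<\<tau> (Suc k)}" using t by (intro islimpt_greaterThanLessThan1) simp
    then have "t islimpt I" by (rule islimpt_subset) (use t in \<open>auto simp: I_def\<close>)
    then show ?thesis by (simp add: trivial_limit_within)
  qed
  have M_t: "M (1, L (1, 0)) = 0"
  proof (rule vector_derivative_unique_within[OF nontrivial])
    have "((\<lambda>s. (s, \<psi> s x)) has_vector_derivative (1, L (1, 0))) (at t within I)"
      by (intro has_vector_derivative_Pair psi_t) (auto intro!: derivative_eq_intros)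
    moreover have "((\<lambda>z. G0 (fst z) (comp_flow G (u (fst z) (snd z)) (snd z))) has_derivative M)
        (at (t, \<psi> t x) within (\<lambda>s. (s, \<psi> s x)) ` I)"
      unfolding l0_def[symmetric] by (rule has_derivative_subset[OF M]) auto
    ultimately show "((\<lambda>s. G0 s (comp_flow G (u s (\<psi> s x)) (\<psi> s x))) has_vector_derivative M (1, L (1, 0))) (at t within I)"
      using vector_derivative_diff_chain_within by (fastforce simp: o_def)
    show "((\<lambda>s. G0 s (comp_flow G (u s (\<psi> s x)) (\<psi> s x))) has_vector_derivative 0) (at t within I)"
      by (rule has_vector_derivative_transform[OF tI _ has_vector_derivative_const]) (use \<Theta> x in auto)
  qed
  have M_x: "M (0, L (0, v)) = v" for v
  proof -
    have "((\<lambda>z. (t, \<psi> t z)) has_derivative (\<lambda>v. (0, L (0, v)))) (at x within ball xs \<gamma>)"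
      unfolding at_x by (intro has_derivative_Pair psi_x has_derivative_const)
    moreover have "((\<lambda>z. G0 (fst z) (comp_flow G (u (fst z) (snd z)) (snd z))) has_derivative M)
        (at (t, \<psi> t x) within (\<lambda>z. (t, \<psi> t z)) ` ball xs \<gamma>)"
      unfolding l0_def[symmetric] by (rule has_derivative_subset[OF M]) (use tI in auto)
    ultimately have "((\<lambda>z. G0 t (comp_flow G (u t (\<psi> t z)) (\<psi> t z))) has_derivative (\<lambda>v. M (0, L (0, v)))) (at x within ball xs \<gamma>)"
      using has_derivative_in_compose by fastforce
    then have "((\<lambda>z. z) has_derivative (\<lambda>v. M (0, L (0, v)))) (at x within ball xs \<gamma>)"
      by (rule has_derivative_transform[OF x, rotated]) (use \<Theta> tI in auto)
    then have "((\<lambda>z. z) has_derivative (\<lambda>v. M (0, L (0, v)))) (at x)" unfolding at_x .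
    from has_derivative_unique[OF this has_derivative_ident] show ?thesis by metis
  qed
  \<comment> \<open>A one-sided inverse of an endomorphism of a finite-dimensional space is two-sided.\<close>
  have L_M: "L (0, M (0, v)) = v" for v
  proof -
    have L_lin: "linear (\<lambda>v. L (0, v))"
    proof (rule linearI)
      show "L (0, x + y) = L (0, x) + L (0, y)" for x y using L.add[of "(0, x)" "(0, y)"] by simp
      show "L (0, r *\<^sub>R x) = r *\<^sub>R L (0, x)" for r x using L.scaleR[of r "(0, x)"] by simp
    qed
    have M_lin: "linear (\<lambda>v. M (0, v))"
    proof (rule linearI)
      show "M (0, x + y) = M (0, x) + M (0, y)" for x y using M.add[of "(0, x)" "(0, y)"] by simp
      show "M (0, r *\<^sub>R x) = r *\<^sub>R M (0, x)" for r x using M.scaleR[of r "(0, x)"] by simp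
    qed
    have "(\<lambda>v. M (0, v)) \<circ> (\<lambda>v. L (0, v)) = id" using M_x by auto
    then have "(\<lambda>v. L (0, v)) \<circ> (\<lambda>v. M (0, v)) = id"
      using linear_inverse_left[OF M_lin L_lin] by blast
    then show ?thesis by (metis comp_apply id_apply)
  qed

  define w where "w = u' (t, l0) (1, 0)"
  define B where "B i = (\<Sum>j\<in>UNIV. b j p0 $ i * w $ j)" for i
  have E_t: "E (1, 0) = g0 x"
  proof (rule vector_derivative_unique_at)
    have "((\<lambda>s. (s, y0)) has_vector_derivative (1, 0)) (at t)"
      by (auto intro!: derivative_eq_intros has_vector_derivative_Pair)
    from vector_derivative_diff_chain_within[OF this, of "\<lambda>(s, y). G0 s y" E]
    show "((\<lambda>s. G0 s y0) has_vector_derivative E (1, 0)) (at t)"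
      using has_derivative_at_withinI[OF E] by (simp add: o_def)
    show "((\<lambda>s. G0 s y0) has_vector_derivative g0 x) (at t)"
      using g0.flow_derivative[of y0 t] l0(2) by simp
  qed
  \<comment> \<open>The orbit of \<open>g\<^sub>0\<close> from \<open>y\<^sub>0\<close> to \<open>x\<close> is the backward orbit of \<open>x\<close>, hence stays within \<open>\<gamma> + d\<close> of the
    centre, where the brackets vanish.\<close>
  have E_g: "E (0, g i y0) = g i x" for i
  proof -
    have "((\<lambda>y. (t, y)) has_derivative (\<lambda>v. (0, v))) (at y0)"
      by (auto intro!: derivative_eq_intros)
    from has_derivative_compose[OF this, of "\<lambda>(s, y). G0 s y" E] E
    have E_y: "(G0 t has_derivative (\<lambda>v. E (0, v))) (at y0)" by simp
    have "E (0, g i y0) = g i (G0 t y0)"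
    proof (rule g0.flow_maps_commuting_field[OF C1_flow.field_derivative[OF Dg] _ _ E_y])
      show "t \<ge> 0" using I_T[OF tI] by simp
      fix s assume s: "s \<in> {0..t}"
      have "G0 s y0 = G0 (s - t) x"
        using g0.flow_add[of "s - t" t y0] l0(2) by simp
      moreover have "norm (G0 (s - t) x - x) \<le> d"
        unfolding d_def using s I_T[OF tI] x pos(1) by (intro disp0) auto
      ultimately have "dist xs (G0 s y0) \<le> dist xs x + d"
        using dist_triangle[of xs "G0 s y0" x] by (simp add: dist_norm norm_minus_commute)
      then have "G0 s y0 \<in> cball xs (3 * \<gamma>)" using x d_le pos(1) by simp
      from commute[OF this, of i]
      show "Dg i (G0 s y0) (g0 (G0 s y0)) = Dg0 (G0 s y0) (g i (G0 s y0))"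
        by (simp add: lie_bracket_def jacobian_mult_eq[OF g0.field_derivative]
            jacobian_mult_eq[OF C1_flow.field_derivative[OF Dg]])
    qed
    then show ?thesis using l0(2) by simp
  qed
  have M_1: "M (1, 0) = g0 x + (\<Sum>i\<in>UNIV. B i *\<^sub>R g i x)"
  proof -
    have E_lin: "linear (\<lambda>v. E (0, v))"
    proof (rule linearI)
      show "E (0, x + y) = E (0, x) + E (0, y)" for x y using E.add[of "(0, x)" "(0, y)"] by simp
      show "E (0, r *\<^sub>R x) = r *\<^sub>R E (0, x)" for r x using E.scaleR[of r "(0, x)"] by simp
    qed
    have "Cd (w, 0) = (\<Sum>j\<in>UNIV. w $ j *\<^sub>R (\<Sum>i\<in>UNIV. (b j p0 $ i) *\<^sub>R g i y0))"
      unfolding y0_def by (rule comp_flow_parameter_derivative[OF rep pos(3) p0 _ Cd])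
        (use l0(1) in \<open>simp add: S_def\<close>)
    then have "E (0, Cd (w, 0)) = (\<Sum>j\<in>UNIV. w $ j *\<^sub>R (\<Sum>i\<in>UNIV. (b j p0 $ i) *\<^sub>R g i x))"
      by (simp add: linear_sum[OF E_lin] linear_cmul[OF E_lin] E_g)
    also have "\<dots> = (\<Sum>i\<in>UNIV. \<Sum>j\<in>UNIV. (b j p0 $ i * w $ j) *\<^sub>R g i x)"
      by (subst sum.swap) (simp add: scaleR_sum_right mult.commute)
    also have "\<dots> = (\<Sum>i\<in>UNIV. B i *\<^sub>R g i x)" by (simp add: B_def scaleR_sum_left)
    finally show ?thesis
      using E.add[of "(1, 0)" "(0, Cd (w, 0))"] by (simp add: M_def w_def[symmetric] E_t)
  qed
  have beta: "((\<lambda>s. beta b u i s l0) has_vector_derivative B i) (at t within I)" for i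
    unfolding B_def p0_def I_def has_real_derivative_iff_has_vector_derivative[symmetric]
    by (rule beta_has_derivative[OF rep adm bv partition C1_pieces k t])
      (use u'(2)[OF tI, of l0] in \<open>simp_all add: w_def I_def\<close>)
  have "L (1, 0) + L (0, M (1, 0)) = 0"
  proof -
    have "M (1, 0) = - M (0, L (1, 0))"
      using M_t M.add[of "(1, 0)" "(0, L (1, 0))"] by (simp add: eq_neg_iff_add_eq_0)
    moreover have "L (0, - v) = - L (0, v)" for v
      using L.scaleR[of "- 1" "(0, v)"] by simp
    ultimately show ?thesis using L_M[of "L (1, 0)"] by simp
  qed
  show "(\<exists>!l. solves G0 G u (cball xs (2 * \<gamma>)) t x l) \<and>
           (\<lambda>s. \<psi> s x) differentiable (at t within {\<tau> k..<\<tau> (Suc k)}) \<and>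
           \<psi> t differentiable (at x) \<and>
           (\<forall>i. (\<lambda>s. beta b u i s (\<psi> t x)) differentiable (at t within {\<tau> k..<\<tau> (Suc k)})) \<and>
           vector_derivative (\<lambda>s. \<psi> s x) (at t within {\<tau> k..<\<tau> (Suc k)})
             + jacobian (\<psi> t) (at x) *v
                 (g0 x + (\<Sum>i\<in>UNIV.
                    vector_derivative (\<lambda>s. beta b u i s (\<psi> t x)) (at t within {\<tau> k..<\<tau> (Suc k)})
                      *\<^sub>R g i x)) = 0"
    unfolding I_def[symmetric] S_def[symmetric] l0_def[symmetric]
  proof (intro conjI allI)
    show "\<exists>!l. solves G0 G u S t x l" by (rule ex1[OF tI x])
    show "(\<lambda>s. \<psi> s x) differentiable (at t within I)"
      using psi_t by (auto simp: has_vector_derivative_def differentiable_def)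
    show "\<psi> t differentiable (at x)" using psi_x by (auto simp: differentiable_def)
    show "(\<lambda>s. beta b u i s l0) differentiable (at t within I)" for i
      using beta[of i] by (auto simp: has_vector_derivative_def differentiable_def)
    show "vector_derivative (\<lambda>s. \<psi> s x) (at t within I) + jacobian (\<psi> t) (at x) *v
        (g0 x + (\<Sum>i\<in>UNIV. vector_derivative (\<lambda>s. beta b u i s l0) (at t within I) *\<^sub>R g i x)) = 0"
      unfolding vector_derivative_within[OF nontrivial psi_t] vector_derivative_within[OF nontrivial beta]
        jacobian_mult_eq[OF psi_x] M_1[symmetric] by fact
  qed
qed

end
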